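(* $\mathcal E_{2,7}\mathcal E_{4,7}+\mathcal E_{2,7}\mathcal E_{1,7}+\mathcal E_{4,7}\mathcal E_{1,7}=0.$
   Context: $q=e^{2\pi i\tau}$. For an odd Dirichlet character $\chi$ mod $7$, $E_{1,\chi}(\tau)=1+\frac{2}{L(0,\chi)}\sum_{n\ge1}\chi(n)\frac{q^n}{1-q^n}$ ($L(0,\chi)$ the value at $0$ of the continued $L$-function). For $a$ coprime to $7$, $\mathcal E_{a,7}=\frac{2}{6}\sum_{\chi\text{ odd mod }7}\chi(a)E_{1,\chi}$ (equivalently $(\gamma_{21}\tau+\gamma_{22})^{-1}\mathcal E_{1,7}(\gamma\tau)$ for $\gamma\in SL(2,\mathbb Z)$, $\gamma_{21}\equiv0$, $\gamma_{22}\equiv a\pmod 7$). *)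

theory Defs
  imports "HOL-Complex_Analysis.Complex_Analysis" "HOL-Number_Theory.Number_Theory"
begin

text \<open>A Dirichlet character modulo \<open>N\<close>, extended by zero to a function on the integers.
  The normalisation \<open>\<psi> 1 = 1\<close> follows from multiplicativity and \<open>\<psi> 1 \<noteq> 0\<close>.\<close>

definition dirichlet_char :: "nat \<Rightarrow> (int \<Rightarrow> complex) \<Rightarrow> bool" where
  "dirichlet_char N \<psi> \<longleftrightarrow>
     (\<forall>n. \<psi> (n + int N) = \<psi> n) \<and>
     (\<forall>m n. \<psi> (m * n) = \<psi> m * \<psi> n) \<and>
     (\<forall>n. \<psi> n \<noteq> 0 \<longleftrightarrow> coprime n (int N))"

definition odd_dirichlet_chars :: "nat \<Rightarrow> (int \<Rightarrow> complex) set" where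
  "odd_dirichlet_chars N = {\<psi>. dirichlet_char N \<psi> \<and> \<psi> (-1) = -1}"

text \<open>The analytically continued \<open>L\<close>-function of a non-principal character (every odd
  character is non-principal): the entire function that agrees with the Dirichlet series
  for \<open>Re s > 1\<close>. It is unique by the identity theorem. For a principal character,
  whose \<open>L\<close>-function has a pole at 1, this definition carries no information.\<close>

definition Dirichlet_L :: "(int \<Rightarrow> complex) \<Rightarrow> complex \<Rightarrow> complex" where
  "Dirichlet_L \<psi> =
     (THE f. f holomorphic_on UNIV \<and>
        (\<forall>s. Re s > 1 \<longrightarrow>
           (\<lambda>n. \<psi> (int (Suc n)) / (of_nat (Suc n) powr s)) sums f s))"

definition nome :: "complex \<Rightarrow> complex" where
  "nome \<tau> = exp (2 * of_real pi * \<i> * \<tau>)"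

definition eisenstein_E1 :: "(int \<Rightarrow> complex) \<Rightarrow> complex \<Rightarrow> complex" where
  "eisenstein_E1 \<psi> \<tau> =
     1 + 2 / Dirichlet_L \<psi> 0 *
       (\<Sum>n. \<psi> (int (Suc n)) * (nome \<tau> ^ Suc n / (1 - nome \<tau> ^ Suc n)))"

definition eisenstein_E_7 :: "int \<Rightarrow> complex \<Rightarrow> complex" where
  "eisenstein_E_7 a \<tau> = 2 / 6 * (\<Sum>\<psi>\<in>odd_dirichlet_chars 7. \<psi> a * eisenstein_E1 \<psi> \<tau>)"

text \<open>So the sum in \<open>eisenstein_E_7\<close> is not the default value 0 of an infinite sum.\<close>

lemma finite_odd_dirichlet_chars_7: "finite (odd_dirichlet_chars 7)"
proof -
  let ?R = "\<lambda>\<psi>. restrict \<psi> {0..<7 :: int}"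
  let ?V = "{z :: complex. z = 0 \<or> z ^ 6 = 1}"
  have per: "\<psi> n = \<psi> (n mod 7)" if "dirichlet_char 7 \<psi>" for \<psi> n
  proof -
    have step: "\<psi> (k + 7) = \<psi> k" for k
      using that by (simp add: dirichlet_char_def)
    have nat_steps: "\<psi> (k + 7 * int j) = \<psi> k" for k j
    proof (induction j)
      case (Suc j)
      then show ?case using step[of "k + 7 * int j"] by (simp add: algebra_simps)
    qed simp
    have "\<psi> (k + 7 * j) = \<psi> k" for k j
    proof (cases "j \<ge> 0")
      case True
      then show ?thesis using nat_steps[of k "nat j"] by simp
    next
      case False
      then show ?thesis using nat_steps[of "k + 7 * j" "nat (- j)"] by simp
    qed
    from this[of "n mod 7" "n div 7"] show ?thesis by simp
  qed
  have val: "\<psi> n \<in> ?V" if \<psi>: "dirichlet_char 7 \<psi>" for \<psi> n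
  proof (cases "coprime n 7")
    case False
    then show ?thesis using \<psi> by (auto simp: dirichlet_char_def)
  next
    case True
    have mult: "\<psi> (m * k) = \<psi> m * \<psi> k" for m k
      using \<psi> by (simp add: dirichlet_char_def)
    have "\<psi> 1 \<noteq> 0" using \<psi> by (simp add: dirichlet_char_def)
    with mult[of 1 1] have one: "\<psi> 1 = 1" by simp
    have pow: "\<psi> (n ^ k) = \<psi> n ^ k" for k
      by (induction k) (simp_all add: one mult)
    have "n mod 7 \<in> {1..6}"
    proof -
      have "\<not> 7 dvd n" using True by (metis coprime_common_divisor_int dvd_refl abs_numeral
          one_eq_numeral_iff semiring_norm(84))
      then have "n mod 7 \<noteq> 0" by (simp add: dvd_eq_mod_eq_0)
      moreover have "0 \<le> n mod 7" "n mod 7 < 7" by simp_all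
      ultimately show ?thesis by (simp only: atLeastAtMost_iff) linarith
    qed
    then have "n mod 7 \<in> {1, 2, 3, 4, 5, 6}" by auto
    then have "(n mod 7) ^ 6 mod 7 = 1" by auto
    then have "n ^ 6 mod 7 = 1" by (simp add: power_mod)
    then have "\<psi> (n ^ 6) = 1" using per[OF \<psi>, of "n ^ 6"] one by simp
    then show ?thesis by (simp add: pow)
  qed
  have "inj_on ?R (odd_dirichlet_chars 7)"
  proof (rule inj_onI)
    fix \<psi> \<phi> assume *: "\<psi> \<in> odd_dirichlet_chars 7" "\<phi> \<in> odd_dirichlet_chars 7" "?R \<psi> = ?R \<phi>"
    show "\<psi> = \<phi>"
    proof
      fix n
      have "?R \<psi> (n mod 7) = ?R \<phi> (n mod 7)" using *(3) by simp
      then have "\<psi> (n mod 7) = \<phi> (n mod 7)" by simp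
      then show "\<psi> n = \<phi> n"
        using per[of \<psi> n] per[of \<phi> n] * by (simp add: odd_dirichlet_chars_def)
    qed
  qed
  moreover have "?R ` odd_dirichlet_chars 7 \<subseteq> {0..<7} \<rightarrow>\<^sub>E ?V"
    using val by (fastforce simp: odd_dirichlet_chars_def)
  moreover have "finite ?V"
  proof -
    have "finite {z :: complex. z ^ 6 = 1}" by (rule finite_roots_unity) simp
    moreover have "?V = insert 0 {z. z ^ 6 = 1}" by auto
    ultimately show ?thesis by simp
  qed
  then have "finite ({0..<7 :: int} \<rightarrow>\<^sub>E ?V)" by (intro finite_PiE) simp_all
  ultimately show ?thesis by (meson finite_imageD finite_subset)
qed

end

(* Write Z(x) for the Weierstrass zeta function in the multiplicative variable x, as a
   regularised sum of half cotangents (1 + X) / (2 (1 - X)) over X = x q^k. Summing the addition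
   law of the cotangent over k + l + m = 0 gives, whenever x y z = 1,
     Z(x) Z(y) + Z(y) Z(z) + Z(z) Z(x) = - 1/4 + D(x) + D(y) + D(z)
   with D even. For a primitive 7th root of unity w, the triples (w, w^2, w^4), (w, w, w^-2) and
   the two Galois conjugates of the latter let one eliminate D; what remains is
   sum of squares = 5 * (second elementary symmetric function) for Z(w), Z(w^2), Z(w^4).
   These values are Lambert series, and so are the Eisenstein series once L(0, chi) is known,
   which is found by continuing L(s, chi) through repeated summation by parts. In terms of three
   basic Lambert series the relation for Z and the claimed one agree up to a constant factor. *)
theory Submission
  imports Defs
begin

section \<open>The addition law for the zeta function\<close>

text \<open>Level 7 is special because 1, 2, 4, the squares modulo 7, are closed under doubling and
  add up to 7. Hence, Z being odd and D even, all four relations involve the same three values of Z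
  and the same three of D, and D drops out without being computed. The other obstacle is the
  constant terms: those of Z on one side, the 1 in E_{1, \<chi>} and L(0, \<chi>) on the other. Both
  come from the sawtooth 1/2 - k/7. The half cotangent of a 7th root of unity x \<noteq> 1 is the
  sum of (1/2 - k/7) x^k over 1 \<le> k \<le> 6, and L(0, \<chi>) is the sum of (1/2 - k/7)
  \<chi>(k) over the same k. So the same shifts 5/14, 3/14, -1/14, the sawtooth at k = 1, 2, 4,
  absorb the constants on both sides, and the remaining algebra is between homogeneous quadratic
  forms.\<close>

definition half_sgn :: "int \<Rightarrow> complex" where
  "half_sgn k = of_int (sgn k) / 2"

lemma half_sgn_simps [simp]:
  "half_sgn 0 = 0" "k > 0 \<Longrightarrow> half_sgn k = 1 / 2" "k < 0 \<Longrightarrow> half_sgn k = - 1 / 2"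
  by (auto simp: half_sgn_def)

lemma has_sum_product_UNIV:
  fixes f :: "'a \<Rightarrow> complex" and g :: "'b \<Rightarrow> complex"
  assumes "(\<lambda>x. norm (f x)) summable_on UNIV" "(\<lambda>x. norm (g x)) summable_on UNIV"
  shows "((\<lambda>(x, y). f x * g y) has_sum (infsum f UNIV * infsum g UNIV)) UNIV"
proof -
  have "(\<lambda>p. norm (case p of (x, y) \<Rightarrow> f x * g y)) summable_on UNIV \<times> UNIV"
    using assms by (subst Infinite_Sum.abs_summable_on_Sigma_iff)
      (auto simp: norm_mult abs_mult infsum_cmult_right' infsum_cmult_left'
         intro!: summable_on_cmult_right summable_on_cmult_left)
  then have "(\<lambda>(x, y). f x * g y) summable_on UNIV \<times> UNIV"
    by (rule abs_summable_summable)
  moreover have "(f has_sum infsum f UNIV) UNIV" "(g has_sum infsum g UNIV) UNIV"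
    using assms by (simp_all add: abs_summable_summable has_sum_infsum)
  ultimately have "((\<lambda>(x, y). f x * g y) has_sum (infsum f UNIV * infsum g UNIV)) (UNIV \<times> UNIV)"
    by (intro has_sum_SigmaI[where g = "\<lambda>x. f x * infsum g UNIV"])
      (simp_all add: has_sum_cmult_right has_sum_cmult_left)
  then show ?thesis by simp
qed

text \<open>Outside the interval from -k to 0 the two signs cancel. Inside, for k > 0, they agree at
  k - 1 points, each giving -1, and the two end points give -1/2 each because
  \<open>half_sgn 0 = 0\<close>.\<close>

lemma has_sum_half_sgn_pos:
  assumes "k \<ge> 0"
  shows "((\<lambda>l. half_sgn l + half_sgn (- k - l)) has_sum (- of_int k)) UNIV"
    and "((\<lambda>l. norm (half_sgn l + half_sgn (- k - l))) has_sum of_int k) UNIV"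
proof -
  let ?f = "\<lambda>l. half_sgn l + half_sgn (- k - l)"
  have outside: "?f l = 0" if "l \<notin> {-k..0}" for l
    using that assms by (auto simp: not_le)
  have val: "sum ?f {-k..0} = - of_int k \<and> (\<Sum>l\<in>{-k..0}. norm (?f l)) = of_int k"
  proof (cases "k = 0")
    case False
    have split: "{-k..0} = insert 0 (insert (-k) {-k<..<0})" using assms by auto
    have mid: "?f l = - 1" if "l \<in> {-k<..<0}" for l
      using that by simp
    have "(\<Sum>l\<in>{-k<..<0}. ?f l) = (\<Sum>l\<in>{-k<..<0}. -1)"
      "(\<Sum>l\<in>{-k<..<0}. norm (?f l)) = (\<Sum>l\<in>{-k<..<0}. 1)"
      by (intro sum.cong refl; simp only: mid norm_minus_cancel norm_one)+
    moreover have "int (card {-k<..<0}) = k - 1"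
      using assms False by simp
    then have "of_nat (card {-k<..<0}) = (of_int (k - 1) :: complex)"
      "of_nat (card {-k<..<0}) = (of_int (k - 1) :: real)"
      by (metis of_int_of_nat_eq)+
    ultimately show ?thesis
      using assms False unfolding split by simp
  qed simp
  show "(?f has_sum (- of_int k)) UNIV" "((\<lambda>l. norm (?f l)) has_sum of_int k) UNIV"
    by (rule has_sum_finite_neutralI[of "{-k..0}"]; use outside val in auto)+
qed

lemma has_sum_half_sgn:
  "((\<lambda>l. half_sgn l + half_sgn (- k - l)) has_sum (- of_int k)) UNIV"
  "((\<lambda>l. norm (half_sgn l + half_sgn (- k - l))) has_sum of_int \<bar>k\<bar>) UNIV"
proof -
  let ?f = "\<lambda>k l. half_sgn l + half_sgn (- k - l)"
  have "(?f k has_sum (- of_int k)) UNIV \<and> ((\<lambda>l. norm (?f k l)) has_sum of_int \<bar>k\<bar>) UNIV"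
  proof (cases "k \<ge> 0")
    case True
    then show ?thesis using has_sum_half_sgn_pos[of k] by (simp only: abs_of_nonneg)
  next
    case False
    have refl: "?f k = (\<lambda>l. - ?f (-k) (-l))"
      by (auto simp: half_sgn_def sgn_if)
    have bij: "bij_betw uminus (UNIV :: int set) UNIV"
      by (rule bij_uminus)
    have "((\<lambda>l. ?f (-k) (-l)) has_sum - of_int (-k)) UNIV"
      using has_sum_half_sgn_pos(1)[of "-k"] False
      by (subst has_sum_reindex_bij_betw[OF bij, of "?f (-k)"]) simp
    then have "(?f k has_sum - (- of_int (-k))) UNIV"
      unfolding refl by (rule has_sum_uminusI)
    moreover have "((\<lambda>l. norm (?f (-k) (-l))) has_sum of_int (-k)) UNIV"
      using has_sum_half_sgn_pos(2)[of "-k"] False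
      by (subst has_sum_reindex_bij_betw[OF bij, of "\<lambda>l. norm (?f (-k) l)"]) simp
    then have "((\<lambda>l. norm (?f k l)) has_sum of_int (-k)) UNIV"
      by (simp only: fun_cong[OF refl] norm_minus_cancel)
    ultimately show ?thesis using False by simp
  qed
  then show "(?f k has_sum (- of_int k)) UNIV" "((\<lambda>l. norm (?f k l)) has_sum of_int \<bar>k\<bar>) UNIV"
    by simp_all
qed

text \<open>The inner norms add up to the absolute value of k, which is the weight in the
  hypothesis; so the double series converges absolutely although neither sign can be summed
  alone.\<close>

lemma has_sum_weighted_half_sgn:
  fixes a :: "int \<Rightarrow> complex"
  assumes "(\<lambda>k. norm (of_int k * a k)) summable_on UNIV"
  shows "((\<lambda>(k, l). a k * (half_sgn l + half_sgn (- k - l)))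
           has_sum (- (\<Sum>\<^sub>\<infinity>k. of_int k * a k))) UNIV"
proof -
  let ?t = "\<lambda>k l. half_sgn l + half_sgn (- k - l)"
  have "(\<lambda>p. norm (case p of (k, l) \<Rightarrow> a k * ?t k l)) summable_on (SIGMA k:UNIV. UNIV)"
  proof (rule summable_on_SigmaI)
    show "((\<lambda>l. norm (case (k, l) of (k, l) \<Rightarrow> a k * ?t k l)) has_sum (norm (a k) * of_int \<bar>k\<bar>)) UNIV"
      for k using has_sum_half_sgn(2)[of k] by (simp add: norm_mult has_sum_cmult_right)
    show "(\<lambda>k. norm (a k) * of_int \<bar>k\<bar>) summable_on UNIV"
      using assms by (simp add: norm_mult mult.commute)
  qed simp
  then have "(\<lambda>(k, l). a k * ?t k l) summable_on UNIV \<times> UNIV"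
    by (rule abs_summable_summable)
  moreover have "((\<lambda>k. - (of_int k * a k)) has_sum - (\<Sum>\<^sub>\<infinity>k. of_int k * a k)) UNIV"
    by (intro has_sum_uminusI has_sum_infsum abs_summable_summable[OF assms])
  moreover have "((\<lambda>l. a k * ?t k l) has_sum (- (of_int k * a k))) UNIV" for k
    using has_sum_cmult_right[OF has_sum_half_sgn(1), of "a k" k] by (simp add: mult.commute)
  ultimately have "((\<lambda>(k, l). a k * ?t k l) has_sum (- (\<Sum>\<^sub>\<infinity>k. of_int k * a k))) (UNIV \<times> UNIV)"
    by (intro has_sum_SigmaI[where g = "\<lambda>k. - (of_int k * a k)"]) simp_all
  then show ?thesis by simp
qed

text \<open>The double series over \<open>k + l + m = 0\<close> converge only after the constant parts
  \<open>half_sgn\<close> are split off; those parts recombine to the weights \<open>k\<close> because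
  \<open>half_sgn l + half_sgn m\<close> summed over \<open>l + m = - k\<close> is \<open>- k\<close>.\<close>

lemma zero_sum_triple_series:
  fixes a b c :: "int \<Rightarrow> complex"
  assumes summable: "(\<lambda>x. norm (a x)) summable_on UNIV" "(\<lambda>x. norm (b x)) summable_on UNIV"
      "(\<lambda>x. norm (c x)) summable_on UNIV"
    and weighted: "(\<lambda>k. norm (of_int k * a k)) summable_on UNIV"
      "(\<lambda>k. norm (of_int k * b k)) summable_on UNIV" "(\<lambda>k. norm (of_int k * c k)) summable_on UNIV"
    and add: "\<And>k l m. k + l + m = 0 \<Longrightarrow>
      (a k + half_sgn k) * (b l + half_sgn l) + (b l + half_sgn l) * (c m + half_sgn m)
        + (c m + half_sgn m) * (a k + half_sgn k) = - 1 / 4"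
  shows "infsum a UNIV * infsum b UNIV + infsum b UNIV * infsum c UNIV + infsum c UNIV * infsum a UNIV
    = - 1 / 4 + (\<Sum>\<^sub>\<infinity>k. of_int k * a k) + (\<Sum>\<^sub>\<infinity>k. of_int k * b k) + (\<Sum>\<^sub>\<infinity>k. of_int k * c k)"
proof -
  let ?t = "\<lambda>k l. half_sgn l + half_sgn (- k - l)"
  \<comment> \<open>Rotations of a triple (k, l, m) with k + l + m = 0, stored by two consecutive
    entries; they put all six series on one index set.\<close>
  let ?rot1 = "\<lambda>(k, l). (l, - k - l :: int)" and ?rot2 = "\<lambda>(k, l). (- k - l :: int, k)"
  have bij: "bij_betw ?rot1 UNIV UNIV" "bij_betw ?rot2 UNIV UNIV"
    by (rule bij_betw_byWitness[where f' = ?rot2], auto)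
       (rule bij_betw_byWitness[where f' = ?rot1], auto)
  have "((\<lambda>(k, l). a k * b l) has_sum (infsum a UNIV * infsum b UNIV)) UNIV"
    by (intro has_sum_product_UNIV summable)
  moreover have "((\<lambda>p. case ?rot1 p of (k, l) \<Rightarrow> b k * c l) has_sum (infsum b UNIV * infsum c UNIV)) UNIV"
    by (rule has_sum_reindex_bij_betw[where f = "\<lambda>(k, l). b k * c l", OF bij(1), THEN iffD2])
       (intro has_sum_product_UNIV summable)
  moreover have "((\<lambda>p. case ?rot2 p of (k, l) \<Rightarrow> c k * a l) has_sum (infsum c UNIV * infsum a UNIV)) UNIV"
    by (rule has_sum_reindex_bij_betw[where f = "\<lambda>(k, l). c k * a l", OF bij(2), THEN iffD2])
       (intro has_sum_product_UNIV summable)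
  moreover have "((\<lambda>(k, l). a k * ?t k l) has_sum (- (\<Sum>\<^sub>\<infinity>k. of_int k * a k))) UNIV"
    by (intro has_sum_weighted_half_sgn weighted)
  moreover have "((\<lambda>p. case ?rot1 p of (k, l) \<Rightarrow> b k * ?t k l) has_sum (- (\<Sum>\<^sub>\<infinity>k. of_int k * b k))) UNIV"
    by (rule has_sum_reindex_bij_betw[where f = "\<lambda>(k, l). b k * ?t k l", OF bij(1), THEN iffD2])
       (intro has_sum_weighted_half_sgn weighted)
  moreover have "((\<lambda>p. case ?rot2 p of (k, l) \<Rightarrow> c k * ?t k l) has_sum (- (\<Sum>\<^sub>\<infinity>k. of_int k * c k))) UNIV"
    by (rule has_sum_reindex_bij_betw[where f = "\<lambda>(k, l). c k * ?t k l", OF bij(2), THEN iffD2])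
       (intro has_sum_weighted_half_sgn weighted)
  ultimately have "((\<lambda>p. (case p of (k, l) \<Rightarrow> a k * b l) + (case ?rot1 p of (k, l) \<Rightarrow> b k * c l)
      + (case ?rot2 p of (k, l) \<Rightarrow> c k * a l) + (case p of (k, l) \<Rightarrow> a k * ?t k l)
      + (case ?rot1 p of (k, l) \<Rightarrow> b k * ?t k l) + (case ?rot2 p of (k, l) \<Rightarrow> c k * ?t k l))
      has_sum (infsum a UNIV * infsum b UNIV + infsum b UNIV * infsum c UNIV
        + infsum c UNIV * infsum a UNIV + - (\<Sum>\<^sub>\<infinity>k. of_int k * a k)
        + - (\<Sum>\<^sub>\<infinity>k. of_int k * b k) + - (\<Sum>\<^sub>\<infinity>k. of_int k * c k))) UNIV"
    (is "(?F has_sum ?S) UNIV") by (intro has_sum_add)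
  \<comment> \<open>The signs alone satisfy the addition law at every zero-sum triple except the
    origin, where they give 0. So everything cancels termwise away from the origin, and the constant
    is counted once.\<close>
  moreover have "?F p = (if p = (0, 0) then - 1 / 4 else 0)" for p
  proof -
    obtain k l where p: "p = (k, l)" by (cases p)
    have signs: "half_sgn k * half_sgn l + half_sgn l * half_sgn (- k - l) + half_sgn (- k - l) * half_sgn k
        = (if k = 0 \<and> l = 0 then 0 else - 1 / 4)"
      by (auto simp: half_sgn_def sgn_if)
    have "- k - (- k - l) = l" "- l - (- k - l) = k" "- (- k - l) - k = l" by simp_all
    then have "?F p = (a k + half_sgn k) * (b l + half_sgn l)
        + (b l + half_sgn l) * (c (- k - l) + half_sgn (- k - l))
        + (c (- k - l) + half_sgn (- k - l)) * (a k + half_sgn k)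
        - (half_sgn k * half_sgn l + half_sgn l * half_sgn (- k - l) + half_sgn (- k - l) * half_sgn k)"
      unfolding p by (simp add: algebra_simps)
    also have "\<dots> = (if p = (0, 0) then - 1 / 4 else 0)"
      unfolding p signs by (subst add) auto
    finally show ?thesis .
  qed
  then have "(?F has_sum (- 1 / 4)) UNIV"
    by (intro has_sum_finite_neutralI[of "{(0, 0)}"]) (simp_all only: sum.insert sum.empty, simp_all)
  ultimately have "?S = - 1 / 4" by (rule has_sum_unique)
  then show ?thesis by (simp add: algebra_simps)
qed

section \<open>Bilateral sums and Lambert series\<close>

lemma has_sum_int:
  fixes f :: "int \<Rightarrow> 'a :: {topological_comm_monoid_add, t2_space}"
  assumes "((\<lambda>n. f (int (Suc n))) has_sum S) UNIV" "((\<lambda>n. f (- int (Suc n))) has_sum T) UNIV"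
  shows "(f has_sum (f 0 + S + T)) UNIV"
proof -
  have "bij_betw (\<lambda>n. int (Suc n)) UNIV {0<..}" "bij_betw (\<lambda>n. - int (Suc n)) UNIV {..<0}"
    by (rule bij_betw_byWitness[where f' = "\<lambda>k. nat (k - 1)"]; auto)
       (rule bij_betw_byWitness[where f' = "\<lambda>k. nat (- k - 1)"]; auto)
  then have "(f has_sum S) {0<..}" "(f has_sum T) {..<0}"
    using assms has_sum_reindex_bij_betw[where f = f] by blast+
  moreover have "(f has_sum f 0) {0}" by (rule has_sum_finiteI) auto
  ultimately have "(f has_sum (f 0 + S + T)) ({0} \<union> {0<..} \<union> {..<0})"
    by (intro has_sum_Un_disjoint) auto
  moreover have "{0} \<union> {0<..} \<union> {..<0} = (UNIV :: int set)" by auto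
  ultimately show ?thesis by simp
qed

lemma has_sum_geometric_Suc:
  fixes z :: "'a :: {real_normed_field, banach}"
  assumes "norm z < 1"
  shows "((\<lambda>n. z ^ Suc n) has_sum (z / (1 - z))) UNIV"
proof (rule norm_summable_imp_has_sum)
  show "summable (\<lambda>n. norm (z ^ Suc n))"
    using summable_mult[OF summable_geometric[of "norm z"], of "norm z"] assms
    by (simp add: norm_mult norm_power)
  show "(\<lambda>n. z ^ Suc n) sums (z / (1 - z))"
    using sums_mult[OF geometric_sums[OF assms], of z] by simp
qed

lemma norm_geometric_tail_le:
  fixes q x :: complex
  assumes "norm q < 1" "norm x = 1"
  shows "norm (x * q ^ Suc n / (1 - x * q ^ Suc n)) \<le> norm q ^ Suc n / (1 - norm q)"
proof -
  have "norm q ^ Suc n \<le> norm q"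
    using assms power_decreasing[of 1 "Suc n" "norm q"] by simp
  moreover have "norm (1 - x * q ^ Suc n) \<ge> 1 - norm (x * q ^ Suc n)"
    using norm_triangle_ineq2[of 1 "x * q ^ Suc n"] by simp
  ultimately have "norm (1 - x * q ^ Suc n) \<ge> 1 - norm q"
    using assms by (simp add: norm_mult norm_power)
  then show ?thesis
    using assms by (simp add: norm_divide norm_mult norm_power frac_le)
qed

text \<open>Each term is a geometric series in \<open>x * q ^ Suc k\<close>; the double series
  converges absolutely and is summed in the other order, which trades translates x q^k for a power
  series in x.\<close>

lemma has_sum_lambert_swap:
  fixes q x :: complex
  assumes q: "norm q < 1" and x: "norm x = 1"
  shows "((\<lambda>k. x * q ^ Suc k / (1 - x * q ^ Suc k))
    has_sum (\<Sum>n. x ^ Suc n * (q ^ Suc n / (1 - q ^ Suc n)))) UNIV"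
    and "summable (\<lambda>n. x ^ Suc n * (q ^ Suc n / (1 - q ^ Suc n)))"
proof -
  let ?f = "\<lambda>(k, n). x ^ Suc n * (q ^ Suc n) ^ Suc k"
  let ?S = "infsum ?f UNIV"
  have small: "norm q ^ Suc k < 1" for k
    using q power_Suc_less_one[of "norm q" k] by (cases "q = 0") auto
  have "(\<lambda>p. norm (?f p)) summable_on (SIGMA k:UNIV. UNIV)"
  proof (rule summable_on_SigmaI)
    show "((\<lambda>n. norm (?f (k, n))) has_sum (norm q ^ Suc k / (1 - norm q ^ Suc k))) UNIV" for k
    proof -
      have "norm (?f (k, n)) = (norm q ^ Suc k) ^ Suc n" for n
        unfolding prod.case norm_mult norm_power x power_one mult_1_left power_mult[symmetric]
        by (simp only: mult.commute)
      then show ?thesis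
        using has_sum_geometric_Suc[of "norm q ^ Suc k"] small[of k]
        by (simp add: norm_power del: power_Suc)
    qed
    have "summable (\<lambda>k. norm q * norm q ^ k / (1 - norm q))"
      using q by (intro summable_divide summable_mult summable_geometric) simp
    moreover have "norm (norm q ^ Suc k / (1 - norm q ^ Suc k)) \<le> norm q * norm q ^ k / (1 - norm q)" for k
    proof -
      have "norm q ^ Suc k \<le> norm q"
        using q power_decreasing[of 1 "Suc k" "norm q"] by simp
      then have "norm q ^ Suc k / (1 - norm q ^ Suc k) \<le> norm q ^ Suc k / (1 - norm q)"
        using q small[of k] by (intro frac_le) auto
      then show ?thesis using small[of k] by (simp add: abs_of_nonneg)
    qed
    ultimately have "summable (\<lambda>k. norm (norm q ^ Suc k / (1 - norm q ^ Suc k)))"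
      by - (erule summable_comparison_test'[where N = 0], simp del: power_Suc of_nat_Suc)
    then show "(\<lambda>k. norm q ^ Suc k / (1 - norm q ^ Suc k)) summable_on UNIV"
      by (rule norm_summable_imp_summable_on)
  qed simp
  then have S: "(?f has_sum ?S) (UNIV \<times> UNIV)"
    by (simp add: abs_summable_summable)
  have inner1: "((\<lambda>n. ?f (k, n)) has_sum (x * q ^ Suc k / (1 - x * q ^ Suc k))) UNIV" for k
  proof -
    have "x ^ Suc n * (q ^ Suc n) ^ Suc k = (x * q ^ Suc k) ^ Suc n" for n
      unfolding power_mult_distrib power_mult[symmetric] by (simp only: mult.commute)
    then show ?thesis
      using has_sum_geometric_Suc[of "x * q ^ Suc k"] small[of k] x
      by (simp only: prod.case norm_mult norm_power mult_1_left)
  qed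
  have inner2: "((\<lambda>k. ?f (k, n)) has_sum (x ^ Suc n * (q ^ Suc n / (1 - q ^ Suc n)))) UNIV" for n
    using has_sum_cmult_right[OF has_sum_geometric_Suc[of "q ^ Suc n"], of "x ^ Suc n"] small[of n]
    by (simp only: prod.case norm_power)
  have "((\<lambda>k. x * q ^ Suc k / (1 - x * q ^ Suc k)) has_sum ?S) UNIV"
    using S inner1 by (rule has_sum_SigmaD)
  moreover have "((\<lambda>(n, k). ?f (k, n)) has_sum ?S) (UNIV \<times> UNIV)"
    using S by (subst has_sum_swap) (simp add: case_prod_unfold)
  then have "((\<lambda>n. x ^ Suc n * (q ^ Suc n / (1 - q ^ Suc n))) has_sum ?S) UNIV"
    by (rule has_sum_SigmaD) (use inner2 in simp)
  then have "(\<lambda>n. x ^ Suc n * (q ^ Suc n / (1 - q ^ Suc n))) sums ?S"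
    by (rule has_sum_imp_sums)
  ultimately show "((\<lambda>k. x * q ^ Suc k / (1 - x * q ^ Suc k))
      has_sum (\<Sum>n. x ^ Suc n * (q ^ Suc n / (1 - q ^ Suc n)))) UNIV"
    "summable (\<lambda>n. x ^ Suc n * (q ^ Suc n / (1 - q ^ Suc n)))"
    by (auto simp: sums_iff)
qed

section \<open>The half cotangent and the zeta function\<close>

text \<open>For X = exp (2 i u) this is (i/2) cot u.\<close>

definition half_cot :: "complex \<Rightarrow> complex" where
  "half_cot X = (1 + X) / (2 * (1 - X))"

text \<open>This is cot u cot v + cot v cot w + cot w cot u = 1 for u + v + w in pi Z, scaled by
  (i/2)^2.\<close>

lemma half_cot_add:
  assumes "X * Y * W = 1" "X \<noteq> 1" "Y \<noteq> 1" "W \<noteq> 1"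
  shows "half_cot X * half_cot Y + half_cot Y * half_cot W + half_cot W * half_cot X = - 1 / 4"
proof -
  define Q where "Q = (1 - X) * (1 - Y) * (1 - W)"
  have Q: "Q \<noteq> 0" and ne: "1 - X \<noteq> 0" "1 - Y \<noteq> 0" "1 - W \<noteq> 0"
    using assms by (simp_all add: Q_def)
  have prod: "u / (2 * a) * (v / (2 * b)) = u * v * c / (4 * (a * b * c))"
    if "a \<noteq> 0" "b \<noteq> 0" "c \<noteq> 0" for a b c u v :: complex
    using that by simp
  have Q_perm: "(1 - X) * (1 - Y) * (1 - W) = Q" "(1 - Y) * (1 - W) * (1 - X) = Q"
    "(1 - W) * (1 - X) * (1 - Y) = Q"
    by (simp_all only: Q_def mult_ac)
  have "half_cot X * half_cot Y = (1 + X) * (1 + Y) * (1 - W) / (4 * Q)"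
    "half_cot Y * half_cot W = (1 + Y) * (1 + W) * (1 - X) / (4 * Q)"
    "half_cot W * half_cot X = (1 + W) * (1 + X) * (1 - Y) / (4 * Q)"
    unfolding half_cot_def
    by (rule prod[OF ne, unfolded Q_perm] prod[OF ne(2,3,1), unfolded Q_perm]
        prod[OF ne(3,1,2), unfolded Q_perm])+
  then have "half_cot X * half_cot Y + half_cot Y * half_cot W + half_cot W * half_cot X
      = ((1 + X) * (1 + Y) * (1 - W) + (1 + Y) * (1 + W) * (1 - X) + (1 + W) * (1 + X) * (1 - Y)) / (4 * Q)"
    by (simp only: add_divide_distrib)
  \<comment> \<open>A polynomial identity in three free variables; the constraint on the product
    enters only through the last summand.\<close>
  also have "(1 + X) * (1 + Y) * (1 - W) + (1 + Y) * (1 + W) * (1 - X) + (1 + W) * (1 + X) * (1 - Y)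
      = - Q + 4 * (1 - X * Y * W)"
    by (simp add: Q_def algebra_simps)
  finally show ?thesis
    unfolding assms(1) using Q by simp
qed

text \<open>\<open>zeta_term q x k\<close> is \<open>half_cot (x * q powi k)\<close> minus its limit \<open>half_sgn k\<close> as
  \<open>k\<close> tends to \<open>\<plusminus> \<infinity>\<close>; the sum over \<open>k\<close> is the Weierstrass zeta function in the
  multiplicative variable \<open>x\<close>, up to normalisation.\<close>

definition zeta_term :: "complex \<Rightarrow> complex \<Rightarrow> int \<Rightarrow> complex" where
  "zeta_term q x k =
     (if k = 0 then half_cot x
      else if k > 0 then x * q ^ nat k / (1 - x * q ^ nat k)
      else - (inverse x * q ^ nat (- k) / (1 - inverse x * q ^ nat (- k))))"

text \<open>Adding 1/2 to Y / (1 - Y) gives the half cotangent of Y. For negative k the term uses Y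
  = 1 / (x q^k), under whose inversion the half cotangent changes sign.\<close>

lemma zeta_term_add_half_sgn:
  assumes "q \<noteq> 0" "norm q < 1" "norm x = 1"
  shows "zeta_term q x k + half_sgn k = half_cot (x * q powi k)"
proof -
  have ne: "1 - y * q ^ n \<noteq> 0" if "n > 0" "norm y = 1" for y n
  proof
    assume "1 - y * q ^ n = 0"
    then have "norm (y * q ^ n) = 1" by (metis eq_iff_diff_eq_0 norm_one)
    then have "norm q ^ n = 1" using that by (simp add: norm_mult norm_power)
    then show False
      using assms that power_less_one_iff[of "norm q" n] by simp
  qed
  have x0: "x \<noteq> 0" using assms by auto
  consider "k = 0" | "k > 0" | "k < 0" by linarith
  then show ?thesis
  proof cases
    case 2
    then show ?thesis
      using ne[of "nat k" x] assms by (simp add: zeta_term_def half_cot_def power_int_def field_simps)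
  next
    case 3
    define p where "p = q ^ nat (- k)"
    have p: "p \<noteq> 0" using assms by (simp add: p_def)
    have "1 - inverse x * p \<noteq> 0"
      using ne[of "nat (- k)" "inverse x"] assms 3 by (simp add: p_def norm_inverse)
    then have "x - p \<noteq> 0" "p - x \<noteq> 0" using x0 by auto
    then have "- (inverse x * p / (1 - inverse x * p)) - 1 / 2 = (1 + x * inverse p) / (2 * (1 - x * inverse p))"
      using x0 p by (simp add: divide_simps) (simp add: algebra_simps)
    then show ?thesis
      using 3 by (simp add: zeta_term_def half_cot_def power_int_def p_def power_inverse)
  qed (simp add: zeta_term_def)
qed

lemma summable_weighted_zeta_term:
  assumes "norm q < 1" "norm x = 1"
  shows "(\<lambda>k. norm (of_int k * zeta_term q x k)) summable_on UNIV"
proof -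
  have pos: "(\<lambda>n. norm (of_nat (Suc n) * (y * q ^ Suc n / (1 - y * q ^ Suc n)))) summable_on UNIV"
    if y: "norm y = 1" for y
  proof -
    have "summable (\<lambda>n. of_nat (Suc n) * norm q ^ n)"
      using assms by (intro sums_summable[OF geometric_deriv_sums]) simp
    then have "summable (\<lambda>n. of_nat (Suc n) * norm q ^ n * (norm q / (1 - norm q)))"
      by (rule summable_mult2)
    moreover have "norm (of_nat (Suc n) * (y * q ^ Suc n / (1 - y * q ^ Suc n)))
        \<le> of_nat (Suc n) * norm q ^ n * (norm q / (1 - norm q))" for n
      using mult_left_mono[OF norm_geometric_tail_le[OF assms(1) y, of n], of "of_nat (Suc n)"]
      by (simp only: norm_mult norm_of_nat power_Suc) (simp only: times_divide_eq_right mult_ac)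
    ultimately have "summable (\<lambda>n. norm (of_nat (Suc n) * (y * q ^ Suc n / (1 - y * q ^ Suc n))))"
      by - (erule summable_comparison_test'[where N = 0], simp del: power_Suc of_nat_Suc)
    then show ?thesis
      by (intro norm_summable_imp_summable_on) simp
  qed
  let ?f = "\<lambda>k. norm (of_int k * zeta_term q x k)"
  have "(\<lambda>n. ?f (int (Suc n))) summable_on UNIV" "(\<lambda>n. ?f (- int (Suc n))) summable_on UNIV"
    using pos[of x] pos[of "inverse x"] assms
    by (simp_all add: zeta_term_def norm_mult norm_inverse del: of_nat_Suc power_Suc)
  then show ?thesis
    using has_sum_int[of ?f] unfolding summable_on_def by blast
qed

lemma summable_zeta_term:
  assumes "norm q < 1" "norm x = 1"
  shows "(\<lambda>k. norm (zeta_term q x k)) summable_on UNIV"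
proof -
  have "(\<lambda>k. norm (zeta_term q x k)) summable_on (UNIV - {0})"
  proof (rule summable_on_comparison_test)
    show "(\<lambda>k. norm (of_int k * zeta_term q x k)) summable_on (UNIV - {0})"
      using summable_weighted_zeta_term[OF assms] by (rule summable_on_subset_banach) simp
    show "norm (zeta_term q x k) \<le> norm (of_int k * zeta_term q x k)" if "k \<in> UNIV - {0}" for k
    proof -
      have "1 * norm (zeta_term q x k) \<le> of_int \<bar>k\<bar> * norm (zeta_term q x k)"
        using that by (intro mult_right_mono) auto
      then show ?thesis by (simp add: norm_mult)
    qed
  qed simp
  then have "(\<lambda>k. norm (zeta_term q x k)) summable_on (insert 0 (UNIV - {0}))"
    by (subst summable_on_insert_iff)
  then show ?thesis by (simp add: insert_absorb)
qed

definition zeta_fun :: "complex \<Rightarrow> complex \<Rightarrow> complex" where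
  "zeta_fun q x = (\<Sum>\<^sub>\<infinity>k. zeta_term q x k)"

text \<open>The function D of the addition law. It is minus the logarithmic derivative q d/dq of the
  product of (1 - x q^k) (1 - q^k / x) over k > 0.\<close>

definition zeta_weighted :: "complex \<Rightarrow> complex \<Rightarrow> complex" where
  "zeta_weighted q x = (\<Sum>\<^sub>\<infinity>k. of_int k * zeta_term q x k)"

lemma zeta_fun_triple:
  assumes q: "q \<noteq> 0" "norm q < 1"
    and norm1: "norm x = 1" "norm y = 1" "norm z = 1"
    and ne: "x \<noteq> 1" "y \<noteq> 1" "z \<noteq> 1"
    and xyz: "x * y * z = 1"
  shows "zeta_fun q x * zeta_fun q y + zeta_fun q y * zeta_fun q z + zeta_fun q z * zeta_fun q x
    = - 1 / 4 + zeta_weighted q x + zeta_weighted q y + zeta_weighted q z"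
  unfolding zeta_fun_def zeta_weighted_def
proof (rule zero_sum_triple_series)
  have ne1: "w * q powi k \<noteq> 1" if "norm w = 1" "w \<noteq> 1" for w k
  proof
    assume eq: "w * q powi k = 1"
    then have "norm q powi k = 1"
      using that by (metis mult_cancel_right1 norm_mult norm_one norm_power_int)
    moreover have "norm q ^ nat (- k) = 1" if "k < 0"
      using calculation that by (simp add: power_int_def power_inverse split: if_splits)
    ultimately have "k = 0"
      using q power_less_one_iff[of "norm q" "nat k"] power_less_one_iff[of "norm q" "nat (- k)"]
      by (cases k "0 :: int" rule: linorder_cases) (simp_all add: power_int_def)
    then show False using eq that by simp
  qed
  show "(zeta_term q x k + half_sgn k) * (zeta_term q y l + half_sgn l) +
        (zeta_term q y l + half_sgn l) * (zeta_term q z m + half_sgn m) +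
        (zeta_term q z m + half_sgn m) * (zeta_term q x k + half_sgn k) = - 1 / 4"
    if klm: "k + l + m = 0" for k l m
  proof -
    have "x * q powi k * (y * q powi l) * (z * q powi m) = x * y * z * (q powi (k + l + m))"
      using q by (simp add: power_int_add mult_ac)
    then have "x * q powi k * (y * q powi l) * (z * q powi m) = 1"
      by (simp add: klm xyz)
    then show ?thesis
      unfolding zeta_term_add_half_sgn[OF q norm1(1)] zeta_term_add_half_sgn[OF q norm1(2)]
        zeta_term_add_half_sgn[OF q norm1(3)]
      using norm1 ne by (intro half_cot_add ne1)
  qed
qed (use q norm1 in \<open>auto intro: summable_zeta_term summable_weighted_zeta_term\<close>)

lemma zeta_term_inverse: "norm x = 1 \<Longrightarrow> x \<noteq> 1 \<Longrightarrow> zeta_term q (inverse x) k = - zeta_term q x (- k)"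
proof -
  assume x: "norm x = 1" "x \<noteq> 1"
  then have x0: "x \<noteq> 0" and "1 - x \<noteq> 0" "x - 1 \<noteq> 0" by auto
  then have "half_cot (inverse x) = - half_cot x"
    unfolding half_cot_def by (simp add: divide_simps) (simp add: algebra_simps)
  then show ?thesis by (simp add: zeta_term_def)
qed

text \<open>Both follow by replacing k by -k; in the weighted sum the weight contributes a second
  sign.\<close>

lemma zeta_fun_inverse:
  assumes "norm x = 1" "x \<noteq> 1"
  shows "zeta_fun q (inverse x) = - zeta_fun q x"
    and "zeta_weighted q (inverse x) = zeta_weighted q x"
proof -
  have bij: "bij_betw uminus (UNIV :: int set) UNIV"
    by (rule bij_uminus)
  show "zeta_fun q (inverse x) = - zeta_fun q x"
    unfolding zeta_fun_def zeta_term_inverse[OF assms] infsum_uminus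
    using infsum_reindex_bij_betw[OF bij, of "zeta_term q x"] by simp
  show "zeta_weighted q (inverse x) = zeta_weighted q x"
    unfolding zeta_weighted_def zeta_term_inverse[OF assms]
    using infsum_reindex_bij_betw[OF bij, of "\<lambda>k. of_int k * zeta_term q x k"] by simp
qed

lemma zeta_fun_lambert:
  assumes "norm q < 1" "norm x = 1"
  shows "zeta_fun q x = half_cot x
    + (\<Sum>n. (x ^ Suc n - inverse x ^ Suc n) * (q ^ Suc n / (1 - q ^ Suc n)))"
proof -
  let ?L = "\<lambda>y. \<Sum>n. y ^ Suc n * (q ^ Suc n / (1 - q ^ Suc n))"
  have inv: "norm (inverse x) = 1" using assms by (simp add: norm_inverse)
  have "(zeta_term q x has_sum (zeta_term q x 0 + ?L x + - ?L (inverse x))) UNIV"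
    using has_sum_lambert_swap(1)[OF assms] has_sum_uminusI[OF has_sum_lambert_swap(1)[OF assms(1) inv]]
    by (intro has_sum_int) (simp_all add: zeta_term_def nat_add_distrib del: power_Suc of_nat_Suc)
  then have "zeta_fun q x = half_cot x + (?L x - ?L (inverse x))"
    unfolding zeta_fun_def by (subst infsumI) (auto simp: zeta_term_def add_diff_eq)
  also have "?L x - ?L (inverse x) = (\<Sum>n. x ^ Suc n * (q ^ Suc n / (1 - q ^ Suc n))
      - inverse x ^ Suc n * (q ^ Suc n / (1 - q ^ Suc n)))"
    by (intro suminf_diff has_sum_lambert_swap(2) assms inv)
  finally show ?thesis by (simp only: left_diff_distrib)
qed

section \<open>Dirichlet L-functions at zero\<close>

definition neg_diff :: "(nat \<Rightarrow> 'a :: ab_group_add) \<Rightarrow> nat \<Rightarrow> 'a" where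
  "neg_diff g n = g n - g (Suc n)"

definition zero_mean_periodic :: "nat \<Rightarrow> (nat \<Rightarrow> complex) \<Rightarrow> bool" where
  "zero_mean_periodic N f \<longleftrightarrow> N > 0 \<and> (\<forall>n. f (n + N) = f n) \<and> (\<Sum>n<N. f n) = 0"

text \<open>The integration constant that makes \<open>antidiff N f\<close> sum to zero over a
  period, so that the operation can be iterated.\<close>

definition antidiff_const :: "nat \<Rightarrow> (nat \<Rightarrow> complex) \<Rightarrow> complex" where
  "antidiff_const N f = - (\<Sum>n<N. \<Sum>k\<le>n. f k) / of_nat N"

definition antidiff :: "nat \<Rightarrow> (nat \<Rightarrow> complex) \<Rightarrow> nat \<Rightarrow> complex" where
  "antidiff N f n = antidiff_const N f + (\<Sum>k\<le>n. f k)"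

lemma zero_mean_periodic_antidiff:
  assumes "zero_mean_periodic N f"
  shows "zero_mean_periodic N (antidiff N f)"
proof -
  have N: "N > 0" and per: "\<And>n. f (n + N) = f n" and zero: "(\<Sum>n<N. f n) = 0"
    using assms by (auto simp: zero_mean_periodic_def)
  have "(\<Sum>k\<le>n + N. f k) = (\<Sum>k\<le>n. f k)" for n
  proof (induction n)
    case 0
    have "(\<Sum>k\<le>N. f k) = (\<Sum>k<N. f k) + f N"
      by (simp add: lessThan_Suc_atMost[symmetric])
    then show ?case using zero per[of 0] by simp
  next
    case (Suc n)
    then show ?case using per[of "Suc n"] by simp
  qed
  moreover have "(\<Sum>n<N. antidiff N f n) = 0"
    using N by (simp add: antidiff_def sum.distrib antidiff_const_def sum_subtractf)
  ultimately show ?thesis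
    using N by (simp add: zero_mean_periodic_def antidiff_def)
qed

lemma zero_mean_periodic_bounded:
  assumes "zero_mean_periodic N f"
  obtains B where "\<And>n. norm (f n) \<le> B" "B \<ge> 0"
proof
  have N: "N > 0" and per: "\<And>n. f (n + N) = f n"
    using assms by (auto simp: zero_mean_periodic_def)
  show "norm (f n) \<le> (\<Sum>k<N. norm (f k))" for n
  proof (induction n rule: less_induct)
    case (less n)
    show ?case
    proof (cases "n < N")
      case True
      then show ?thesis by (intro member_le_sum[of n _ "\<lambda>k. norm (f k)"]) auto
    next
      case False
      then show ?thesis using less[of "n - N"] per[of "n - N"] N by simp
    qed
  qed
qed (simp add: sum_nonneg)

lemma antidiff_summation_by_parts:
  assumes "g \<longlonglongrightarrow> 0" "zero_mean_periodic N f"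
    and "(\<lambda>n. antidiff N f n * neg_diff g n) sums V"
  shows "(\<lambda>n. f n * g n) sums (V - antidiff_const N f * g 0)"
proof -
  obtain B where B: "\<And>n. norm (antidiff N f n) \<le> B"
    by (rule zero_mean_periodic_bounded[OF zero_mean_periodic_antidiff[OF assms(2)]]) (rule that)
  \<comment> \<open>The lower boundary term arises because continuing the antidifference one step to
    the left of 0 gives the integration constant alone.\<close>
  have partial: "(\<Sum>n<Suc M. f n * g n) = (\<Sum>n<Suc M. antidiff N f n * neg_diff g n)
      + antidiff N f M * g (Suc M) - antidiff_const N f * g 0" for M
  proof (induction M)
    case (Suc M)
    then show ?case
      by (simp add: antidiff_def neg_diff_def algebra_simps)
  qed (simp add: antidiff_def neg_diff_def algebra_simps)
  have "(\<lambda>M. antidiff N f M * g (Suc M)) \<longlonglongrightarrow> 0"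
  proof (rule Lim_null_comparison)
    show "\<forall>\<^sub>F M in sequentially. norm (antidiff N f M * g (Suc M)) \<le> B * norm (g (Suc M))"
      using B by (simp add: norm_mult mult_right_mono)
    show "(\<lambda>M. B * norm (g (Suc M))) \<longlonglongrightarrow> 0"
      by (rule tendsto_mult_right_zero, rule tendsto_norm_zero, rule LIMSEQ_Suc, rule assms(1))
  qed
  moreover have "(\<lambda>M. \<Sum>n<Suc M. antidiff N f n * neg_diff g n) \<longlonglongrightarrow> V"
    using assms(3) unfolding sums_def by (rule LIMSEQ_Suc)
  ultimately have "(\<lambda>M. \<Sum>n<Suc M. f n * g n) \<longlonglongrightarrow> V + 0 - antidiff_const N f * g 0"
    unfolding partial by (intro tendsto_diff tendsto_add tendsto_const)
  then show ?thesis
    unfolding sums_def add_0_right by (rule LIMSEQ_imp_Suc)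
qed

section \<open>Iterated differences of complex powers\<close>

text \<open>The functions \<open>G j\<close> are successive derivatives. Each difference is absorbed
  by the mean value inequality on a unit segment (the equality fails for complex values), and the
  half-line carrying the bound is stable under the shift by 1.\<close>

lemma norm_neg_diff_funpow_le:
  fixes G :: "nat \<Rightarrow> complex \<Rightarrow> complex"
  assumes "a > 0"
    and "\<And>j x. j < m \<Longrightarrow> x > 0 \<Longrightarrow> (G j has_field_derivative G (Suc j) (of_real x)) (at (of_real x))"
    and "\<And>x. x \<ge> a + real n \<Longrightarrow> norm (G m (of_real x)) \<le> B"
  shows "norm ((neg_diff ^^ m) (\<lambda>k. G 0 (of_real (a + real k))) n) \<le> B"
  using assms
proof (induction m arbitrary: G)
  case 0
  then show ?case using 0(3)[of "a + real n"] by simp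
next
  case (Suc m)
  define H where "H j z = G j z - G j (z + 1)" for j z
  have deriv: "(G j has_field_derivative G (Suc j) (of_real x)) (at (of_real x))"
    if "j < Suc m" "x > 0" for j x
    using Suc.prems(2) that .
  have H: "(H j has_field_derivative H (Suc j) (of_real x)) (at (of_real x))"
    if "j < m" "x > 0" for j x
  proof -
    have "(G j has_field_derivative G (Suc j) (of_real x + 1)) (at (of_real x + 1))"
      using deriv[of j "x + 1"] that by simp
    then have "((\<lambda>z. G j (z + 1)) has_field_derivative G (Suc j) (of_real x + 1)) (at (of_real x))"
      by (simp only: DERIV_shift)
    then show ?thesis
      unfolding H_def using deriv[of j x] that by (intro DERIV_diff) simp_all
  qed
  have bound: "norm (H m (of_real x)) \<le> B" if x: "x \<ge> a + real n" for x
  proof -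
    let ?S = "of_real ` {x..x + 1} :: complex set"
    have "norm (G m (of_real x) - G m (of_real (x + 1))) \<le> B * norm (of_real x - of_real (x + 1) :: complex)"
    proof (rule field_differentiable_bound[where S = ?S and f' = "G (Suc m)"])
      show "convex ?S"
        by (intro convex_linear_image linear_of_real convex_real_interval)
      show "(G m has_field_derivative G (Suc m) z) (at z within ?S)" if z: "z \<in> ?S" for z
      proof -
        obtain y where y: "z = of_real y" "y \<ge> x" using z by auto
        then show ?thesis
          using deriv[of m y] x \<open>a > 0\<close> by (simp add: has_field_derivative_at_within)
      qed
      show "norm (G (Suc m) z) \<le> B" if z: "z \<in> ?S" for z
      proof -
        obtain y where y: "z = of_real y" "y \<ge> x" using z by auto
        then show ?thesis using Suc.prems(3)[of y] x by simp
      qed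
    qed (rule imageI, simp)+
    moreover have "of_real x - of_real (x + 1) = (- 1 :: complex)" by simp
    ultimately show ?thesis by (simp add: H_def)
  qed
  have "norm ((neg_diff ^^ m) (\<lambda>k. H 0 (of_real (a + real k))) n) \<le> B"
    using \<open>a > 0\<close> H bound by (rule Suc.IH)
  moreover have "(\<lambda>k. H 0 (of_real (a + real k))) = neg_diff (\<lambda>k. G 0 (of_real (a + real k)))"
    by (simp add: H_def neg_diff_def fun_eq_iff add_ac)
  ultimately show ?case by (simp only: funpow_Suc_right comp_def)
qed

definition dirichlet_power :: "complex \<Rightarrow> nat \<Rightarrow> complex" where
  "dirichlet_power s n = of_nat (Suc n) powr (- s)"

text \<open>The m-th derivative of z^(-s) is (-1)^m \<open>pochhammer s m\<close> z^(-s-m): each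
  difference gains one power of decay, which moves the half-plane of convergence one unit to the
  left.\<close>

lemma norm_neg_diff_dirichlet_power_le:
  assumes "Re s + real m \<ge> 0"
  shows "norm ((neg_diff ^^ m) (dirichlet_power s) n)
    \<le> norm (pochhammer s m) * real (Suc n) powr (- (Re s + real m))"
proof -
  define G where "G j z = (-1) ^ j * pochhammer s j * z powr (- s - of_nat j)" for j :: nat and z :: complex
  have "norm ((neg_diff ^^ m) (\<lambda>k. G 0 (of_real (1 + real k))) n)
      \<le> norm (pochhammer s m) * real (Suc n) powr (- (Re s + real m))"
  proof (rule norm_neg_diff_funpow_le)
    fix j x assume x: "(x :: real) > 0"
    have "((\<lambda>z. z powr (- s - of_nat j)) has_field_derivative
        (- s - of_nat j) * of_real x powr (- s - of_nat j - 1)) (at (of_real x))"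
      using x by (intro has_field_derivative_powr) (auto simp: complex_nonpos_Reals_iff)
    from DERIV_cmult[OF this, of "(-1) ^ j * pochhammer s j"]
    show "(G j has_field_derivative G (Suc j) (of_real x)) (at (of_real x))"
      unfolding G_def by (simp add: pochhammer_Suc algebra_simps)
  next
    fix x assume x: "x \<ge> 1 + real n"
    have "norm (G m (of_real x)) = norm (pochhammer s m) * x powr (- (Re s + real m))"
      using x by (simp add: G_def norm_mult norm_power norm_powr_real_powr)
    also have "x powr (- (Re s + real m)) \<le> real (Suc n) powr (- (Re s + real m))"
      using x assms by (intro powr_mono2') auto
    finally show "norm (G m (of_real x)) \<le> norm (pochhammer s m) * real (Suc n) powr (- (Re s + real m))"
      by (simp add: mult_left_mono)
  qed simp
  moreover have "(\<lambda>k. G 0 (of_real (1 + real k))) = dirichlet_power s"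
    by (simp add: G_def dirichlet_power_def fun_eq_iff)
  ultimately show ?thesis by simp
qed

lemma norm_pochhammer_le:
  fixes s :: complex
  assumes "norm s \<le> R"
  shows "norm (pochhammer s m) \<le> pochhammer R m"
proof (induction m)
  case (Suc m)
  have "norm (s + of_nat m) \<le> R + real m"
    using norm_triangle_ineq[of s "of_nat m"] assms by simp
  then show ?case
    unfolding pochhammer_Suc norm_mult
    using Suc by (intro mult_mono order_trans[OF norm_ge_zero Suc]) auto
qed simp

lemma holomorphic_neg_diff_dirichlet_power:
  "(\<lambda>s. (neg_diff ^^ m) (dirichlet_power s) n) holomorphic_on A"
proof (induction m arbitrary: n)
  case 0
  have "(\<lambda>s. of_nat (Suc n) powr (- s)) holomorphic_on A"
    by (intro holomorphic_intros)
  then show ?case by (simp add: dirichlet_power_def)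
next
  case (Suc m)
  show ?case
    unfolding funpow.simps comp_def neg_diff_def[of "(neg_diff ^^ m) _"]
    by (intro holomorphic_on_diff Suc.IH)
qed

section \<open>Analytic continuation and the value at 0\<close>

text \<open>The Dirichlet series \<open>\<Sum>n. f n / (n + 1) ^ s\<close> after \<open>m\<close> summations by parts; the
  remaining series converges for \<open>Re s > 1 - m\<close>.\<close>

definition L_cont :: "nat \<Rightarrow> (nat \<Rightarrow> complex) \<Rightarrow> nat \<Rightarrow> complex \<Rightarrow> complex" where
  "L_cont N f m s =
     (\<Sum>n. (antidiff N ^^ m) f n * (neg_diff ^^ m) (dirichlet_power s) n)
     - (\<Sum>j<m. antidiff_const N ((antidiff N ^^ j) f) * (neg_diff ^^ j) (dirichlet_power s) 0)"

lemma zero_mean_periodic_funpow: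
  "zero_mean_periodic N f \<Longrightarrow> zero_mean_periodic N ((antidiff N ^^ m) f)"
  by (induction m) (auto intro: zero_mean_periodic_antidiff)

text \<open>The bound depends on s only through R and \<sigma>. Modulus and real part of s give
  convergence at s; values common to a disc give the majorant for the Weierstrass test.\<close>

lemma L_cont_majorant:
  assumes "zero_mean_periodic N f"
  obtains B where "B \<ge> 0" "\<And>s R \<sigma> n. norm s \<le> R \<Longrightarrow> \<sigma> \<le> Re s \<Longrightarrow> \<sigma> + real m > 1 \<Longrightarrow>
    norm ((antidiff N ^^ m) f n * (neg_diff ^^ m) (dirichlet_power s) n)
      \<le> B * (pochhammer R m * real (Suc n) powr (- (\<sigma> + real m)))"
proof -
  obtain B where B: "\<And>n. norm ((antidiff N ^^ m) f n) \<le> B" "B \<ge> 0"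
    by (rule zero_mean_periodic_bounded[OF zero_mean_periodic_funpow[OF assms]]) (rule that)
  show ?thesis
  proof (rule that)
    show "B \<ge> 0" by fact
    fix s R \<sigma> n assume s: "norm (s :: complex) \<le> R" "\<sigma> \<le> Re s" "\<sigma> + real m > 1"
    have "norm ((neg_diff ^^ m) (dirichlet_power s) n)
        \<le> norm (pochhammer s m) * real (Suc n) powr (- (Re s + real m))"
      using s by (intro norm_neg_diff_dirichlet_power_le) auto
    also have "\<dots> \<le> pochhammer R m * real (Suc n) powr (- (\<sigma> + real m))"
      using s norm_pochhammer_le[OF s(1), of m] order_trans[OF norm_ge_zero norm_pochhammer_le[OF s(1), of m]]
      by (intro mult_mono powr_mono) auto
    finally show "norm ((antidiff N ^^ m) f n * (neg_diff ^^ m) (dirichlet_power s) n)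
      \<le> B * (pochhammer R m * real (Suc n) powr (- (\<sigma> + real m)))"
      unfolding norm_mult by (intro mult_mono B) auto
  qed
qed

lemma summable_Suc_powr:
  assumes "(\<sigma> :: real) > 1"
  shows "summable (\<lambda>n. C * (D * real (Suc n) powr (- \<sigma>)))"
proof -
  have "summable (\<lambda>n. real (Suc n) powr (- \<sigma>))"
    using assms summable_real_powr_iff[of "- \<sigma>"] by (subst summable_Suc_iff) simp
  then show ?thesis by (intro summable_mult)
qed

lemma summable_L_cont:
  assumes "zero_mean_periodic N f" "Re s + real m > 1"
  shows "summable (\<lambda>n. (antidiff N ^^ m) f n * (neg_diff ^^ m) (dirichlet_power s) n)"
proof -
  obtain B where B: "B \<ge> 0" "\<And>s R \<sigma> n. norm s \<le> R \<Longrightarrow> \<sigma> \<le> Re s \<Longrightarrow> \<sigma> + real m > 1 \<Longrightarrow>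
      norm ((antidiff N ^^ m) f n * (neg_diff ^^ m) (dirichlet_power s) n)
        \<le> B * (pochhammer R m * real (Suc n) powr (- (\<sigma> + real m)))"
    by (rule L_cont_majorant[OF assms(1), of m]) (rule that)
  show ?thesis
    by (rule summable_comparison_test'[OF summable_Suc_powr[OF assms(2)], where N = 0])
      (rule B(2)[OF order_refl order_refl assms(2)])
qed

lemma L_cont_Suc:
  assumes f: "zero_mean_periodic N f" and s: "Re s + real m > 1"
  shows "L_cont N f (Suc m) s = L_cont N f m s"
proof -
  let ?f = "(antidiff N ^^ m) f" and ?g = "(neg_diff ^^ m) (dirichlet_power s)"
  have "?g \<longlonglongrightarrow> 0"
  proof (rule Lim_null_comparison)
    show "\<forall>\<^sub>F n in sequentially. norm (?g n) \<le> 1 * (norm (pochhammer s m) * real (Suc n) powr (- (Re s + real m)))"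
      using s norm_neg_diff_dirichlet_power_le[of s m] by (simp del: of_nat_Suc)
    show "(\<lambda>n. 1 * (norm (pochhammer s m) * real (Suc n) powr (- (Re s + real m)))) \<longlonglongrightarrow> 0"
      by (rule summable_LIMSEQ_zero) (rule summable_Suc_powr[OF s])
  qed
  moreover have "(\<lambda>n. antidiff N ?f n * neg_diff ?g n) sums
      (\<Sum>n. (antidiff N ^^ Suc m) f n * (neg_diff ^^ Suc m) (dirichlet_power s) n)"
    using summable_sums[OF summable_L_cont[OF f, of s "Suc m"]] s by simp
  ultimately have "(\<lambda>n. ?f n * ?g n) sums
      ((\<Sum>n. (antidiff N ^^ Suc m) f n * (neg_diff ^^ Suc m) (dirichlet_power s) n) - antidiff_const N ?f * ?g 0)"
    using zero_mean_periodic_funpow[OF f] by (intro antidiff_summation_by_parts)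
  from sums_unique[OF this] show ?thesis
    by (simp add: L_cont_def del: funpow.simps)
qed

lemma holomorphic_L_cont:
  assumes f: "zero_mean_periodic N f"
  shows "L_cont N f m holomorphic_on {s. Re s > 1 - real m}"
proof -
  let ?S = "{s. Re s > 1 - real m}"
  let ?t = "\<lambda>n s. (antidiff N ^^ m) f n * (neg_diff ^^ m) (dirichlet_power s) n"
  have "(\<lambda>s. \<Sum>n. ?t n s) holomorphic_on ?S"
  proof (rule holomorphic_uniform_sequence)
    show open_S: "open ?S" by (rule open_halfspace_Re_gt)
    show "(\<lambda>s. \<Sum>n<k. ?t n s) holomorphic_on ?S" for k
      by (intro holomorphic_on_sum holomorphic_on_mult holomorphic_on_const holomorphic_neg_diff_dirichlet_power)
    fix x assume "x \<in> ?S"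
    then obtain d where d: "d > 0" "cball x d \<subseteq> ?S"
      using open_S open_contains_cball by metis
    obtain B where B: "B \<ge> 0" "\<And>s R \<sigma> n. norm s \<le> R \<Longrightarrow> \<sigma> \<le> Re s \<Longrightarrow> \<sigma> + real m > 1 \<Longrightarrow>
        norm (?t n s) \<le> B * (pochhammer R m * real (Suc n) powr (- (\<sigma> + real m)))"
      by (rule L_cont_majorant[OF f, of m]) (rule that)
    \<comment> \<open>The least real part on the closed disc; the point attaining it lies in the
      open half-plane, so the exponent stays strictly above 1.\<close>
    define \<sigma> where "\<sigma> = Re x - d"
    have "x - of_real d \<in> ?S" using d(1) by (intro subsetD[OF d(2)]) (simp add: dist_norm)
    then have \<sigma>: "\<sigma> + real m > 1" by (simp add: \<sigma>_def)
    have "uniform_limit (cball x d) (\<lambda>k s. \<Sum>n<k. ?t n s) (\<lambda>s. \<Sum>n. ?t n s) sequentially"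
    proof (rule Weierstrass_m_test)
      show "summable (\<lambda>n. B * (pochhammer (norm x + d) m * real (Suc n) powr (- (\<sigma> + real m))))"
        using \<sigma> by (rule summable_Suc_powr)
      fix n s assume "s \<in> cball x d"
      then have "norm (s - x) \<le> d" by (simp add: dist_norm norm_minus_commute)
      then have "norm s \<le> norm x + d" "\<sigma> \<le> Re s"
        using norm_triangle_sub[of s x] abs_Re_le_cmod[of "s - x"] by (auto simp: \<sigma>_def)
      then show "norm (?t n s) \<le> B * (pochhammer (norm x + d) m * real (Suc n) powr (- (\<sigma> + real m)))"
        using \<sigma> by (rule B(2))
    qed
    then show "\<exists>d>0. cball x d \<subseteq> ?S \<and>
        uniform_limit (cball x d) (\<lambda>k s. \<Sum>n<k. ?t n s) (\<lambda>s. \<Sum>n. ?t n s) sequentially"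
      using d by blast
  qed
  then show ?thesis
    unfolding L_cont_def[abs_def]
    by (intro holomorphic_on_diff holomorphic_on_sum holomorphic_on_mult holomorphic_on_const
        holomorphic_neg_diff_dirichlet_power)
qed

lemma L_cont_eq:
  assumes "zero_mean_periodic N f" "Re s + real m > 1" "m \<le> m'"
  shows "L_cont N f m' s = L_cont N f m s"
  using assms(3)
proof (induction m' rule: dec_induct)
  case (step n)
  then show ?case using L_cont_Suc[OF assms(1), of s n] assms(2) by simp
qed simp

text \<open>At s = 0 the powers are the constant 1, their differences vanish, and one boundary term
  is left. The value is the average of the partial sums over a period, the Cesaro sum of the
  coefficients.\<close>

lemma Dirichlet_L_0:
  assumes "zero_mean_periodic N (\<lambda>n. \<psi> (int (Suc n)))"
  shows "Dirichlet_L \<psi> 0 = (\<Sum>n<N. \<Sum>k\<le>n. \<psi> (int (Suc k))) / of_nat N"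
proof -
  let ?f = "\<lambda>n. \<psi> (int (Suc n))"
  \<comment> \<open>The local continuations are glued: the number m of summations by parts is chosen
    so that Re s + m \<ge> 2.\<close>
  define L where "L s = L_cont N ?f (nat \<lceil>2 - Re s\<rceil>) s" for s
  have L: "L s = L_cont N ?f m s" if "Re s + real m > 1" for s m
  proof -
    have ceil: "Re s + real (nat \<lceil>2 - Re s\<rceil>) > 1" by linarith
    show ?thesis
      unfolding L_def
    proof (cases m "nat \<lceil>2 - Re s\<rceil>" rule: le_cases)
      case le
      then show "L_cont N ?f (nat \<lceil>2 - Re s\<rceil>) s = L_cont N ?f m s"
        by (rule L_cont_eq[OF assms that])
    next
      case ge
      then show "L_cont N ?f (nat \<lceil>2 - Re s\<rceil>) s = L_cont N ?f m s"
        by (rule L_cont_eq[OF assms ceil, symmetric])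
    qed
  qed
  have hol: "L holomorphic_on UNIV"
  proof -
    have "L holomorphic_on (\<Union>m. {s. Re s > 1 - real m})"
    proof (intro holomorphic_on_UN_open)
      fix m
      have "L_cont N ?f m s = L s" if "s \<in> {s. Re s > 1 - real m}" for s
        using that by (intro L[symmetric]) simp
      with holomorphic_L_cont[OF assms, of m] show "L holomorphic_on {s. Re s > 1 - real m}"
        by (rule holomorphic_transform)
    qed (rule open_halfspace_Re_gt)
    moreover have "s \<in> (\<Union>m. {s. Re s > 1 - real m})" for s
    proof -
      obtain m where "1 - Re s < real m" using reals_Archimedean2 by blast
      then have "s \<in> {s. Re s > 1 - real m}" by simp
      then show ?thesis by blast
    qed
    then have "(\<Union>m. {s. Re s > 1 - real m}) = UNIV" by blast
    ultimately show ?thesis by simp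
  qed
  have sums: "(\<lambda>n. ?f n / (of_nat (Suc n) powr s)) sums L s" if "Re s > 1" for s
  proof -
    have "?f n * dirichlet_power s n = ?f n / (of_nat (Suc n) powr s)" for n
      by (simp only: dirichlet_power_def powr_minus divide_inverse)
    moreover have "L s = (\<Sum>n. ?f n * dirichlet_power s n)"
      using that L[of s 0] by (simp add: L_cont_def)
    ultimately show ?thesis
      using summable_sums[OF summable_L_cont[OF assms, of s 0]] that by simp
  qed
  have unique: "g = L" if g: "g holomorphic_on UNIV"
    "\<And>s. Re s > 1 \<Longrightarrow> (\<lambda>n. ?f n / (of_nat (Suc n) powr s)) sums g s" for g
  proof
    fix z
    show "g z = L z"
    proof (rule analytic_continuation_open[of "{s. Re s > 1}" UNIV g L])
      show "open {s. Re s > 1}" by (rule open_halfspace_Re_gt)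
      have "2 \<in> {s. Re s > 1}" by simp
      then show "{s. Re s > 1} \<noteq> {}" by blast
      show "g s = L s" if "s \<in> {s. Re s > 1}" for s
        using that g(2)[of s] sums[of s] by (simp add: sums_unique2 del: of_nat_Suc)
    qed (use g(1) hol in \<open>simp_all add: connected_UNIV\<close>)
  qed
  have "Dirichlet_L \<psi> = L"
    unfolding Dirichlet_L_def
  proof (rule the_equality)
    show "L holomorphic_on UNIV \<and> (\<forall>s. Re s > 1 \<longrightarrow> (\<lambda>n. ?f n / (of_nat (Suc n) powr s)) sums L s)"
      by (intro conjI allI impI hol sums)
    show "g = L" if "g holomorphic_on UNIV \<and>
        (\<forall>s. Re s > 1 \<longrightarrow> (\<lambda>n. ?f n / (of_nat (Suc n) powr s)) sums g s)" for g
      by (rule unique) (simp_all only: that)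
  qed
  moreover have "L 0 = - antidiff_const N ?f"
  proof -
    have const: "dirichlet_power 0 = (\<lambda>_. 1)" "neg_diff (\<lambda>_. 1 :: complex) = (\<lambda>_. 0)"
      "neg_diff (\<lambda>_. 0 :: complex) = (\<lambda>_. 0)"
      by (simp_all add: dirichlet_power_def neg_diff_def fun_eq_iff del: of_nat_Suc)
    \<comment> \<open>Two summations by parts are the fewest for which Re s + m > 1 at s =
      0.\<close>
    have "L 0 = L_cont N ?f (Suc (Suc 0)) 0" by (rule L) simp
    then show ?thesis
      unfolding L_cont_def funpow.simps comp_def id_def const by (simp add: neg_diff_def)
  qed
  ultimately show ?thesis by (simp add: antidiff_const_def)
qed

section \<open>Level 7\<close>

definition lambert :: "complex \<Rightarrow> (int \<Rightarrow> complex) \<Rightarrow> complex" where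
  "lambert q f = (\<Sum>n. f (int (Suc n)) * (q ^ Suc n / (1 - q ^ Suc n)))"

text \<open>For j = 1, 2, 4, one residue from each pair j, -j, these form a basis of the odd
  functions modulo 7, permuted cyclically by n \<mapsto> 2 n.\<close>

definition odd_delta7 :: "int \<Rightarrow> int \<Rightarrow> complex" where
  "odd_delta7 j n = (if n mod 7 = j then 1 else if n mod 7 = 7 - j then - 1 else 0)"

lemma mod_7_cases:
  fixes n :: int
  obtains "n mod 7 = 0" | "n mod 7 = 1" | "n mod 7 = 2" | "n mod 7 = 3" | "n mod 7 = 4"
    | "n mod 7 = 5" | "n mod 7 = 6"
proof -
  have "0 \<le> n mod 7" "n mod 7 < 7" by simp_all
  then show ?thesis using that by linarith
qed

lemma lambert_odd_mod_7:
  assumes q: "norm q < 1" and per: "\<And>n. f n = f (n mod 7)"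
    and odd: "f 0 = 0" "f 3 = - f 4" "f 5 = - f 2" "f 6 = - f 1"
  shows "lambert q f = f 1 * lambert q (odd_delta7 1) + f 2 * lambert q (odd_delta7 2)
    + f 4 * lambert q (odd_delta7 4)"
proof -
  let ?t = "\<lambda>j n. odd_delta7 j (int (Suc n)) * (q ^ Suc n / (1 - q ^ Suc n))"
  have "summable (\<lambda>n. norm q * norm q ^ n / (1 - norm q))"
    using q by (intro summable_divide summable_mult summable_geometric) simp
  moreover have "norm (?t j n) \<le> norm q * norm q ^ n / (1 - norm q)" for j n
  proof -
    have "norm (odd_delta7 j (int (Suc n))) \<le> 1" by (simp add: odd_delta7_def)
    then have "norm (?t j n) \<le> 1 * (norm q ^ Suc n / (1 - norm q))"
      unfolding norm_mult using norm_geometric_tail_le[OF q, of 1 n] by (intro mult_mono) auto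
    then show ?thesis by simp
  qed
  ultimately have summable: "summable (?t j)" for j
    by (rule summable_comparison_test'[where N = 0])
  have "f n = f 1 * odd_delta7 1 n + f 2 * odd_delta7 2 n + f 4 * odd_delta7 4 n" for n
    by (cases n rule: mod_7_cases) (simp_all add: per[of n] odd odd_delta7_def)
  then have "f (int (Suc n)) * (q ^ Suc n / (1 - q ^ Suc n))
      = f 1 * ?t 1 n + f 2 * ?t 2 n + f 4 * ?t 4 n" for n
    by (metis distrib_right mult.assoc)
  then have "(\<lambda>n. f (int (Suc n)) * (q ^ Suc n / (1 - q ^ Suc n)))
      sums (f 1 * suminf (?t 1) + f 2 * suminf (?t 2) + f 4 * suminf (?t 4))"
    by (simp only:) (intro sums_add sums_mult summable_sums summable)
  then show ?thesis
    unfolding lambert_def by (rule sums_unique[symmetric])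
qed

text \<open>The shifts are the coefficients of \<open>half_cot x\<close>, for a 7th root of unity \<open>x \<noteq> 1\<close>,
  with respect to \<open>x - x ^ 6\<close>, \<open>x ^ 2 - x ^ 5\<close> and \<open>x ^ 4 - x ^ 3\<close>.\<close>

definition lambert7_1 :: "complex \<Rightarrow> complex" where "lambert7_1 q = lambert q (odd_delta7 1) + 5 / 14"
definition lambert7_2 :: "complex \<Rightarrow> complex" where "lambert7_2 q = lambert q (odd_delta7 2) + 3 / 14"
definition lambert7_4 :: "complex \<Rightarrow> complex" where "lambert7_4 q = lambert q (odd_delta7 4) - 1 / 14"

section \<open>The zeta function at seventh roots of unity\<close>

lemma root_of_unity_7_power:
  fixes x :: "'a :: monoid_mult"
  assumes "x ^ 7 = 1"
  shows "x ^ n = x ^ (n mod 7)"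
proof -
  have "x ^ n = x ^ (7 * (n div 7) + n mod 7)" by simp
  also have "\<dots> = x ^ (n mod 7)" using assms by (simp only: power_add power_mult) simp
  finally show ?thesis .
qed

lemma root_of_unity_7_sum:
  fixes x :: complex
  assumes "x ^ 7 = 1" "x \<noteq> 1"
  shows "1 + x + x ^ 2 + x ^ 3 + x ^ 4 + x ^ 5 + x ^ 6 = 0"
proof -
  have "(x - 1) * (1 + x + x ^ 2 + x ^ 3 + x ^ 4 + x ^ 5 + x ^ 6) = x ^ 7 - 1"
    by (simp add: algebra_simps eval_nat_numeral)
  then show ?thesis using assms by simp
qed

lemma zeta_fun_root_of_unity_7:
  assumes q: "norm q < 1" and x: "x ^ 7 = 1" "x \<noteq> 1"
  shows "zeta_fun q x = (x - x ^ 6) * lambert7_1 q + (x ^ 2 - x ^ 5) * lambert7_2 q + (x ^ 4 - x ^ 3) * lambert7_4 q"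
proof -
  have "norm x ^ 7 = 1" using x by (metis norm_one norm_power)
  then have norm_x: "norm x = 1" using power_eq_imp_eq_base[of "norm x" 7 1] by simp
  have inv: "inverse x ^ k = x ^ (7 - k)" if "k \<le> 7" for k
  proof -
    have "x ^ k * x ^ (7 - k) = 1" using that x(1) by (simp flip: power_add)
    then show ?thesis by (simp add: power_inverse inverse_unique)
  qed
  define f where "f n = x ^ nat (n mod 7) - inverse x ^ nat (n mod 7)" for n :: int
  have pow: "y ^ nat (int n mod 7) = y ^ n" if "y ^ 7 = 1" for y :: complex and n
    using root_of_unity_7_power[OF that, of n] by (simp add: nat_mod_distrib)
  have inv7: "inverse x ^ 7 = 1" using x by (simp add: power_inverse)
  have sum: "(\<Sum>n. (x ^ Suc n - inverse x ^ Suc n) * (q ^ Suc n / (1 - q ^ Suc n))) = lambert q f"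
    unfolding lambert_def f_def pow[OF x(1)] pow[OF inv7] ..
  have f_eq: "f n = x ^ nat (n mod 7) - x ^ (7 - nat (n mod 7))" for n
  proof -
    have "nat (n mod 7) \<le> 7" using pos_mod_bound[of 7 n] by linarith
    then show ?thesis by (simp only: f_def inv)
  qed
  have f: "f 1 = x - x ^ 6" "f 2 = x ^ 2 - x ^ 5" "f 3 = x ^ 3 - x ^ 4" "f 4 = x ^ 4 - x ^ 3"
    "f 5 = x ^ 5 - x ^ 2" "f 6 = x ^ 6 - x"
    by (simp_all add: f_eq)
  have lam: "lambert q f = f 1 * lambert q (odd_delta7 1) + f 2 * lambert q (odd_delta7 2)
      + f 4 * lambert q (odd_delta7 4)"
    by (rule lambert_odd_mod_7[OF q]) (simp_all only: f, simp_all add: f_def)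
  \<comment> \<open>The numerators 5, 3, -1 are 14 (1/2 - k/7) at k = 1, 2, 4. They come from 7 / (x
    - 1) being the sum of k x^k over k < 7.\<close>
  have cot: "half_cot x = (5 * (x - x ^ 6) + 3 * (x ^ 2 - x ^ 5) - (x ^ 4 - x ^ 3)) / 14"
  proof -
    have "(5 * (x - x ^ 6) + 3 * (x ^ 2 - x ^ 5) - (x ^ 4 - x ^ 3)) * (2 * (1 - x))
        = (1 + x) * 14 - 4 * (1 + x + x ^ 2 + x ^ 3 + x ^ 4 + x ^ 5 + x ^ 6) + 10 * (x ^ 7 - 1)"
      by (simp add: algebra_simps eval_nat_numeral)
    then have "(1 + x) * 14 = (5 * (x - x ^ 6) + 3 * (x ^ 2 - x ^ 5) - (x ^ 4 - x ^ 3)) * (2 * (1 - x))"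
      unfolding root_of_unity_7_sum[OF x] x(1) by simp
    then show ?thesis using x(2) by (simp add: half_cot_def frac_eq_eq)
  qed
  have arith: "(5 * A + 3 * B - C) / 14 + (A * r + B * s + C * t)
      = A * (r + 5 / 14) + B * (s + 3 / 14) + C * (t - 1 / 14)" for A B C r s t :: complex
    by (simp add: field_simps)
  show ?thesis
    unfolding zeta_fun_lambert[OF q norm_x] sum lam cot f lambert7_1_def lambert7_2_def lambert7_4_def by (rule arith)
qed

text \<open>The four triples \<open>(x, x ^ 2, x ^ 4)\<close>, \<open>(x, x, x ^ -2)\<close>, \<open>(x ^ 2, x ^ 2, x ^ -4)\<close>,
  \<open>(x ^ 4, x ^ 4, x ^ -1)\<close> have product 1, and the weighted sums cancel between the first
  relation and the sum of the other three.\<close>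

lemma lambert7_quadratic_relation:
  assumes "q \<noteq> 0" "norm q < 1"
  shows "lambert7_1 q ^ 2 + lambert7_2 q ^ 2 + lambert7_4 q ^ 2 = 5 * (lambert7_1 q * lambert7_2 q + lambert7_2 q * lambert7_4 q + lambert7_4 q * lambert7_1 q)"
proof -
  define x where "x = cis (2 * pi / 7)"
  have x7: "x ^ 7 = 1" by (simp add: x_def Complex.DeMoivre)
  have "sin (2 * pi / 7) > 0" by (rule sin_gt_zero) simp_all
  then have x1: "x \<noteq> 1" by (auto simp: x_def complex_eq_iff)
  have ne: "x ^ 2 \<noteq> 1" "x ^ 4 \<noteq> 1"
  proof -
    have "x ^ 7 = (x ^ 2) ^ 3 * x" "x ^ 7 * x = (x ^ 4) ^ 2"
      by (simp_all add: eval_nat_numeral)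
    from this[unfolded x7] show "x ^ 2 \<noteq> 1" "x ^ 4 \<noteq> 1"
      using x1 by (metis mult_1 power_one)+
  qed
  have norm: "norm x = 1" "norm (x ^ 2) = 1" "norm (x ^ 4) = 1"
    by (simp_all add: x_def norm_power)
  have x0: "x \<noteq> 0" using norm by auto
  define Z1 Z2 Z4 where "Z1 = zeta_fun q x" and "Z2 = zeta_fun q (x ^ 2)" and "Z4 = zeta_fun q (x ^ 4)"
  define W1 W2 W4 where "W1 = zeta_weighted q x" and "W2 = zeta_weighted q (x ^ 2)"
    and "W4 = zeta_weighted q (x ^ 4)"
  \<comment> \<open>The triple (y, y, 1/z): oddness of \<open>zeta_fun\<close> produces the minus
    signs, and evenness of \<open>zeta_weighted\<close> lets z replace its inverse.\<close>
  have double: "zeta_fun q y * zeta_fun q y - zeta_fun q y * zeta_fun q z - zeta_fun q z * zeta_fun q y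
      = - 1 / 4 + zeta_weighted q y + zeta_weighted q y + zeta_weighted q z"
    if "norm y = 1" "norm z = 1" "y \<noteq> 1" "z \<noteq> 1" "y * y = z" for y z
  proof -
    have "z \<noteq> 0" using that(2) by auto
    then have "y * y * inverse z = 1" using that(5) by simp
    then show ?thesis
      using zeta_fun_triple[of q y y "inverse z"] that assms by (simp add: norm_inverse zeta_fun_inverse)
  qed
  have "x * x ^ 2 * x ^ 4 = x ^ 7" "x * x = x ^ 2" "x ^ 2 * x ^ 2 = x ^ 4" "x ^ 4 * x ^ 4 = x ^ 7 * x"
    by (simp_all add: eval_nat_numeral)
  then have "x * x ^ 2 * x ^ 4 = 1" "x * x = x ^ 2" "x ^ 2 * x ^ 2 = x ^ 4" "x ^ 4 * x ^ 4 = x"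
    unfolding x7 by simp_all
  then have triples: "Z1 * Z2 + Z2 * Z4 + Z4 * Z1 = - 1 / 4 + W1 + W2 + W4"
    "Z1 * Z1 - Z1 * Z2 - Z2 * Z1 = - 1 / 4 + W1 + W1 + W2"
    "Z2 * Z2 - Z2 * Z4 - Z4 * Z2 = - 1 / 4 + W2 + W2 + W4"
    "Z4 * Z4 - Z4 * Z1 - Z1 * Z4 = - 1 / 4 + W4 + W4 + W1"
    unfolding Z1_def Z2_def Z4_def W1_def W2_def W4_def
    using assms norm x1 ne by (blast intro: zeta_fun_triple double)+
  \<comment> \<open>The right-hand sides of the last three relations add up to three times that of
    the first; the mixed products supply two more copies, hence the factor 5.\<close>
  have "Z1 ^ 2 + Z2 ^ 2 + Z4 ^ 2 = (Z1 * Z1 - Z1 * Z2 - Z2 * Z1) + (Z2 * Z2 - Z2 * Z4 - Z4 * Z2)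
      + (Z4 * Z4 - Z4 * Z1 - Z1 * Z4) + 2 * (Z1 * Z2 + Z2 * Z4 + Z4 * Z1)"
    by (simp add: power2_eq_square algebra_simps)
  also have "\<dots> = 5 * (Z1 * Z2 + Z2 * Z4 + Z4 * Z1)"
    unfolding triples by (simp add: field_simps)
  finally have Z: "Z1 ^ 2 + Z2 ^ 2 + Z4 ^ 2 = 5 * (Z1 * Z2 + Z2 * Z4 + Z4 * Z1)" .
  define s1 s2 s4 where "s1 = x - x ^ 6" and "s2 = x ^ 2 - x ^ 5" and "s4 = x ^ 4 - x ^ 3"
  note sum = root_of_unity_7_sum[OF x7 x1]
  \<comment> \<open>Together these say that s1 + s2 + s4 has square -7: it is the quadratic Gauss
    sum modulo 7.\<close>
  have "s1 ^ 2 + s2 ^ 2 + s4 ^ 2 = (1 + x + x ^ 2 + x ^ 3 + x ^ 4 + x ^ 5 + x ^ 6)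
      + (x ^ 7 - 1) * (x ^ 5 + x ^ 3 + x - 6) - 7"
    "s1 * s2 + s2 * s4 + s4 * s1 = (x ^ 7 - 1) * (x ^ 4 - x ^ 3)"
    unfolding s1_def s2_def s4_def by (simp_all add: algebra_simps eval_nat_numeral)
  then have s: "s1 ^ 2 + s2 ^ 2 + s4 ^ 2 = - 7" "s1 * s2 + s2 * s4 + s4 * s1 = 0"
    unfolding sum x7 by simp_all
  have pow: "(x ^ 2) ^ 2 = x ^ 4" "(x ^ 2) ^ 3 = x ^ 6" "(x ^ 2) ^ 4 = x" "(x ^ 2) ^ 5 = x ^ 3"
    "(x ^ 2) ^ 6 = x ^ 5" "(x ^ 4) ^ 2 = x" "(x ^ 4) ^ 3 = x ^ 5" "(x ^ 4) ^ 4 = x ^ 2"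
    "(x ^ 4) ^ 5 = x ^ 6" "(x ^ 4) ^ 6 = x ^ 3" "(x ^ 2) ^ 7 = 1" "(x ^ 4) ^ 7 = 1"
    unfolding power_mult[symmetric] by (subst root_of_unity_7_power[OF x7], simp)+
  have Z_eq: "Z1 = s1 * lambert7_1 q + s2 * lambert7_2 q + s4 * lambert7_4 q" "Z2 = s2 * lambert7_1 q + s4 * lambert7_2 q + s1 * lambert7_4 q"
    "Z4 = s4 * lambert7_1 q + s1 * lambert7_2 q + s2 * lambert7_4 q"
    unfolding Z1_def Z2_def Z4_def s1_def s2_def s4_def zeta_fun_root_of_unity_7[OF assms(2) x7 x1]
      zeta_fun_root_of_unity_7[OF assms(2) pow(11) ne(1)]
      zeta_fun_root_of_unity_7[OF assms(2) pow(12) ne(2)] pow by simp_all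
  \<comment> \<open>The rows of coefficients are cyclic shifts of one another, mutually orthogonal
    and of square length -7, so passing from the Z to the Lambert series multiplies both quadratic
    forms by -7.\<close>
  define P S where "P = lambert7_1 q ^ 2 + lambert7_2 q ^ 2 + lambert7_4 q ^ 2"
    and "S = lambert7_1 q * lambert7_2 q + lambert7_2 q * lambert7_4 q + lambert7_4 q * lambert7_1 q"
  have "Z1 ^ 2 + Z2 ^ 2 + Z4 ^ 2 = (s1 ^ 2 + s2 ^ 2 + s4 ^ 2) * P + 2 * (s1 * s2 + s2 * s4 + s4 * s1) * S"
    "Z1 * Z2 + Z2 * Z4 + Z4 * Z1 = (s1 * s2 + s2 * s4 + s4 * s1) * (P + S) + (s1 ^ 2 + s2 ^ 2 + s4 ^ 2) * S"
    unfolding Z_eq P_def S_def by (simp_all add: algebra_simps power2_eq_square)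
  then have "P = 5 * S" using Z unfolding s by simp
  then show ?thesis unfolding P_def S_def .
qed

section \<open>Odd characters modulo 7 and their Eisenstein series\<close>

text \<open>3 generates the units mod 7, so an odd character is determined by its value \<open>z\<close> at 3,
  a cube root of \<open>- 1\<close>.\<close>

definition char7 :: "complex \<Rightarrow> int \<Rightarrow> complex" where
  "char7 z n = (if n mod 7 = 1 then 1 else if n mod 7 = 2 then z ^ 2 else if n mod 7 = 3 then z
     else if n mod 7 = 4 then - z else if n mod 7 = 5 then - (z ^ 2) else if n mod 7 = 6 then - 1 else 0)"

lemma char7_mod: "char7 z (n mod 7) = char7 z n"
  by (simp add: char7_def)

lemma char7_odd_dirichlet_char:
  assumes z: "z ^ 3 = - 1"
  shows "char7 z \<in> odd_dirichlet_chars 7"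
proof -
  have z0: "z \<noteq> 0" using z by auto
  have "z * z ^ 2 = z ^ 3" "z ^ 2 * z = z ^ 3" "z ^ 4 = z ^ 3 * z" "z * z = z ^ 2"
    by (simp_all add: eval_nat_numeral)
  then have pow: "z * z ^ 2 = - 1" "z ^ 2 * z = - 1" "z ^ 4 = - z" "z * z = z ^ 2"
    unfolding z by simp_all
  have "char7 z (m * n) = char7 z m * char7 z n" for m n
  proof -
    have "char7 z (m * n) = char7 z ((m mod 7) * (n mod 7))"
      using char7_mod[of z "m * n"] char7_mod[of z "(m mod 7) * (n mod 7)"]
      by (simp only: mod_mult_eq)
    also have "\<dots> = char7 z (m mod 7) * char7 z (n mod 7)"
      by (cases m rule: mod_7_cases; cases n rule: mod_7_cases) (simp_all add: char7_def pow)
    finally show ?thesis by (simp only: char7_mod)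
  qed
  moreover have "char7 z n \<noteq> 0 \<longleftrightarrow> coprime n 7" for n
  proof -
    have "prime (7 :: int)" by simp
    then have "coprime n 7 \<longleftrightarrow> \<not> 7 dvd n"
      using coprime_commute prime_imp_coprime coprime_absorb_right not_prime_unit by metis
    also have "\<dots> \<longleftrightarrow> n mod 7 \<noteq> 0" by (simp only: dvd_eq_mod_eq_0)
    finally show ?thesis
      by (cases n rule: mod_7_cases) (simp_all add: char7_def z0)
  qed
  moreover have "char7 z (n + 7) = char7 z n" for n by (simp add: char7_def)
  moreover have "char7 z (- 1) = - 1" by (simp add: char7_def)
  ultimately show ?thesis by (simp add: odd_dirichlet_chars_def dirichlet_char_def)
qed

lemma odd_dirichlet_chars_7: "odd_dirichlet_chars 7 = char7 ` {z. z ^ 3 = - 1}"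
proof
  show "char7 ` {z. z ^ 3 = - 1} \<subseteq> odd_dirichlet_chars 7"
    using char7_odd_dirichlet_char by blast
  show "odd_dirichlet_chars 7 \<subseteq> char7 ` {z. z ^ 3 = - 1}"
  proof
    fix \<psi> assume "\<psi> \<in> odd_dirichlet_chars 7"
    then have per1: "\<And>n. \<psi> (n + 7) = \<psi> n" and mult: "\<And>m n. \<psi> (m * n) = \<psi> m * \<psi> n"
      and unit: "\<And>n. \<psi> n \<noteq> 0 \<longleftrightarrow> coprime n 7" and odd: "\<psi> (- 1) = - 1"
      by (auto simp: odd_dirichlet_chars_def dirichlet_char_def)
    have per_nat: "\<psi> (n + 7 * int k) = \<psi> n" for n k
    proof (induction k)
      case (Suc k)
      then show ?case using per1[of "n + 7 * int k"] by (simp add: algebra_simps)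
    qed simp
    have per: "\<psi> n = \<psi> (n mod 7)" for n
    proof (cases "n \<ge> 0")
      case True
      then show ?thesis
        using per_nat[of "n mod 7" "nat (n div 7)"] by (simp add: pos_imp_zdiv_nonneg_iff)
    next
      case False
      then have "n div 7 < 0" by (simp add: neg_imp_zdiv_neg_iff)
      moreover have "n mod 7 = n + 7 * (- (n div 7))"
        by (simp add: minus_mult_div_eq_mod)
      ultimately show ?thesis
        using per_nat[of n "nat (- (n div 7))"] by simp
    qed
    define z where "z = \<psi> 3"
    have "\<psi> 1 \<noteq> 0" by (simp add: unit)
    then have one: "\<psi> 1 = 1" using mult[of 1 1] by simp
    have two: "\<psi> 2 = z ^ 2" using mult[of 3 3] per[of 9] by (simp add: z_def power2_eq_square)
    have six: "\<psi> 6 = - 1" using per[of "- 1"] odd by simp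
    have zcube: "z ^ 3 = - 1"
      using mult[of 2 3] two six by (simp add: z_def power3_eq_cube power2_eq_square)
    have four: "\<psi> 4 = - z" using mult[of 6 3] per[of 18] six by (simp add: z_def)
    have five: "\<psi> 5 = - (z ^ 2)" using mult[of 6 2] per[of 12] six two by simp
    have zero: "\<psi> 0 = 0" using unit[of 0] by simp
    have "\<psi> n = char7 z n" for n
      by (cases n rule: mod_7_cases)
        (simp_all add: per[of n] char7_def one two four five six zero z_def[symmetric])
    then have "\<psi> = char7 z" by (rule ext)
    then show "\<psi> \<in> char7 ` {z. z ^ 3 = - 1}" using zcube by blast
  qed
qed

text \<open>The Lambert series of the character is X - D / 14 and L(0, \<chi>) = D / 7, so the 1 in
  \<open>eisenstein_E1\<close> cancels and 14 X / D is left, which reduces modulo z^3 + 1 to a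
  quadratic polynomial in z.\<close>

lemma eisenstein_E1_char7:
  assumes z: "z ^ 3 = - 1" and \<tau>: "Im \<tau> > 0"
  shows "eisenstein_E1 (char7 z) \<tau>
    = (2 * lambert7_1 (nome \<tau>) + lambert7_2 (nome \<tau>) - lambert7_4 (nome \<tau>))
      + (- lambert7_1 (nome \<tau>) + lambert7_2 (nome \<tau>) - 2 * lambert7_4 (nome \<tau>)) * z
      + (- lambert7_1 (nome \<tau>) + 2 * lambert7_2 (nome \<tau>) + lambert7_4 (nome \<tau>)) * z ^ 2"
proof -
  define a b c where "a = lambert7_1 (nome \<tau>)" and "b = lambert7_2 (nome \<tau>)" and "c = lambert7_4 (nome \<tau>)"
  define D X where "D = 5 + z + 3 * z ^ 2" and "X = a + z ^ 2 * b - z * c"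
  have "norm (nome \<tau>) < 1" using \<tau> by (simp add: nome_def)
  then have "lambert (nome \<tau>) (char7 z) = char7 z 1 * lambert (nome \<tau>) (odd_delta7 1)
      + char7 z 2 * lambert (nome \<tau>) (odd_delta7 2) + char7 z 4 * lambert (nome \<tau>) (odd_delta7 4)"
    by (rule lambert_odd_mod_7) (simp_all only: char7_mod, simp_all add: char7_def)
  then have "lambert (nome \<tau>) (char7 z) = (a - 5 / 14) + z ^ 2 * (b - 3 / 14) - z * (c + 1 / 14)"
    by (simp add: char7_def a_def b_def c_def lambert7_1_def lambert7_2_def lambert7_4_def)
  also have "\<dots> = X - D / 14"
    unfolding X_def D_def by (simp add: field_simps)
  finally have lam: "lambert (nome \<tau>) (char7 z) = X - D / 14" .
  have "zero_mean_periodic 7 (\<lambda>n. char7 z (int (Suc n)))"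
  proof -
    have "int (Suc (n + 7)) = int (Suc n) + 7" for n by simp
    then have "char7 z (int (Suc (n + 7))) = char7 z (int (Suc n))" for n
      by (simp only: char7_def mod_add_self2)
    moreover have "(\<Sum>n<7. char7 z (int (Suc n))) = 0"
      by (simp add: eval_nat_numeral char7_def)
    ultimately show ?thesis by (simp add: zero_mean_periodic_def)
  qed
  from Dirichlet_L_0[OF this]
  have "Dirichlet_L (char7 z) 0 = (\<Sum>n<7. \<Sum>k\<le>n. char7 z (int (Suc k))) / 7" by simp
  \<comment> \<open>The partial sums over a period are 1, 1 + z^2, 1 + z + z^2, 1 + z^2, 1, 0,
    0.\<close>
  also have "(\<Sum>n<7. \<Sum>k\<le>n. char7 z (int (Suc k))) = D"
    by (simp add: eval_nat_numeral char7_def D_def)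
  finally have L: "Dirichlet_L (char7 z) 0 = D / 7" .
  \<comment> \<open>D is inverted modulo z^3 + 1, hence for all three roots at once, including z =
    -1, the quadratic character.\<close>
  have "D * (2 - z - z ^ 2) = 14 - (3 * z + 4) * (z ^ 3 + 1)"
    by (simp add: D_def algebra_simps power2_eq_square power3_eq_cube)
  then have D: "D * (2 - z - z ^ 2) = 14" unfolding z by simp
  then have "D \<noteq> 0" by auto
  have "14 / D = 2 - z - z ^ 2"
    using D \<open>D \<noteq> 0\<close> by (simp add: divide_eq_eq mult.commute)
  moreover have "eisenstein_E1 (char7 z) \<tau> = 14 / D * X"
    unfolding eisenstein_E1_def lambert_def[symmetric] lam L
    using \<open>D \<noteq> 0\<close> by (simp add: field_simps)
  ultimately have "eisenstein_E1 (char7 z) \<tau> = (2 - z - z ^ 2) * X" by simp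
  also have "\<dots> = (2 * a + b - c) + (- a + b - 2 * c) * z + (- a + 2 * b + c) * z ^ 2
      + (c - b - b * z) * (z ^ 3 + 1)"
    by (simp add: X_def algebra_simps power2_eq_square power3_eq_cube)
  finally show ?thesis
    unfolding z a_def b_def c_def by simp
qed

text \<open>The roots of z^3 + 1 have power sums 0 in degrees 1 and 2, so summing over the
  characters extracts the constant coefficient.\<close>

lemma sum_cube_roots_minus_one:
  fixes a b c :: complex
  shows "(\<Sum>z\<in>{z. z ^ 3 = - 1}. a + b * z + c * z ^ 2) = 3 * a"
proof -
  \<comment> \<open>This is exp (i pi / 3), a primitive sixth root of unity; the third root 1 - w is
    its complex conjugate.\<close>
  define w where "w = Complex (1 / 2) (sqrt 3 / 2)"
  have w: "w ^ 2 = w - 1"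
    by (simp add: w_def complex_eq_iff power2_eq_square)
  have ne: "w \<noteq> - 1" "1 - w \<noteq> - 1" "w \<noteq> 1 - w"
    by (simp_all add: w_def complex_eq_iff)
  have "z ^ 3 = - 1 \<longleftrightarrow> z = - 1 \<or> z = w \<or> z = 1 - w" for z
  proof -
    have "(z + 1) * ((z - w) * (z - (1 - w))) = z ^ 3 + 1 + (z + 1) * (w - 1 - w ^ 2)"
      by (simp add: power2_eq_square power3_eq_cube algebra_simps)
    then have "z ^ 3 + 1 = (z + 1) * ((z - w) * (z - (1 - w)))"
      unfolding w by simp
    then have "z ^ 3 + 1 = 0 \<longleftrightarrow> z + 1 = 0 \<or> z - w = 0 \<or> z - (1 - w) = 0"
      by (simp only: mult_eq_0_iff)
    then show ?thesis by (simp only: add_eq_0_iff2 right_minus_eq)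
  qed
  then have "{z. z ^ 3 = - 1} = {- 1, w, 1 - w}" by blast
  then have "(\<Sum>z\<in>{z. z ^ 3 = - 1}. a + b * z + c * z ^ 2)
      = (a + b * (- 1) + c * (- 1) ^ 2) + (a + b * w + c * w ^ 2) + (a + b * (1 - w) + c * (1 - w) ^ 2)"
    using ne by (simp add: add.assoc)
  also have "\<dots> = 3 * a + 2 * c * (w ^ 2 - w + 1)"
    by (simp add: power2_eq_square algebra_simps)
  finally show ?thesis unfolding w by simp
qed

text \<open>Multiplying by \<open>char7 z 2 = z ^ 2\<close> or \<open>char7 z 4 = - z\<close>
  rotates the three coefficients modulo z^3 + 1, up to sign, so that another one becomes constant
  and survives the sum over z.\<close>

lemma eisenstein_E_7_eq:
  assumes "Im \<tau> > 0"
  shows "eisenstein_E_7 1 \<tau> = 2 * lambert7_1 (nome \<tau>) + lambert7_2 (nome \<tau>) - lambert7_4 (nome \<tau>)"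
    and "eisenstein_E_7 2 \<tau> = lambert7_1 (nome \<tau>) - lambert7_2 (nome \<tau>) + 2 * lambert7_4 (nome \<tau>)"
    and "eisenstein_E_7 4 \<tau> = - lambert7_1 (nome \<tau>) + 2 * lambert7_2 (nome \<tau>) + lambert7_4 (nome \<tau>)"
proof -
  define a b c where "a = 2 * lambert7_1 (nome \<tau>) + lambert7_2 (nome \<tau>) - lambert7_4 (nome \<tau>)"
    and "b = - lambert7_1 (nome \<tau>) + lambert7_2 (nome \<tau>) - 2 * lambert7_4 (nome \<tau>)"
    and "c = - lambert7_1 (nome \<tau>) + 2 * lambert7_2 (nome \<tau>) + lambert7_4 (nome \<tau>)"
  have "inj_on char7 {z. z ^ 3 = - 1}"
  proof (rule inj_onI)
    fix z z' assume "char7 z = char7 z'"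
    then have "char7 z 3 = char7 z' 3" by simp
    then show "z = z'" by (simp add: char7_def)
  qed
  then have E: "eisenstein_E_7 k \<tau>
      = 1 / 3 * (\<Sum>z\<in>{z. z ^ 3 = - 1}. char7 z k * eisenstein_E1 (char7 z) \<tau>)" for k
    unfolding eisenstein_E_7_def odd_dirichlet_chars_7 by (simp add: sum.reindex)
  have "char7 z 1 * eisenstein_E1 (char7 z) \<tau> = a + b * z + c * z ^ 2"
    "char7 z 2 * eisenstein_E1 (char7 z) \<tau> = - b + (- c) * z + a * z ^ 2"
    "char7 z 4 * eisenstein_E1 (char7 z) \<tau> = c + (- a) * z + (- b) * z ^ 2"
    if z: "z \<in> {z. z ^ 3 = - 1}" for z
  proof -
    have z3: "z ^ 3 = - 1" using z by simp
    have eis: "eisenstein_E1 (char7 z) \<tau> = a + b * z + c * z ^ 2"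
      unfolding eisenstein_E1_char7[OF z3 assms] a_def b_def c_def ..
    have "z ^ 2 * (a + b * z + c * z ^ 2) = - b + (- c) * z + a * z ^ 2 + (b + c * z) * (z ^ 3 + 1)"
      "- z * (a + b * z + c * z ^ 2) = c + (- a) * z + (- b) * z ^ 2 - c * (z ^ 3 + 1)"
      by (simp_all add: algebra_simps power2_eq_square power3_eq_cube)
    then show "char7 z 1 * eisenstein_E1 (char7 z) \<tau> = a + b * z + c * z ^ 2"
      "char7 z 2 * eisenstein_E1 (char7 z) \<tau> = - b + (- c) * z + a * z ^ 2"
      "char7 z 4 * eisenstein_E1 (char7 z) \<tau> = c + (- a) * z + (- b) * z ^ 2"
      unfolding eis z3 by (simp_all add: char7_def)
  qed
  then have "eisenstein_E_7 1 \<tau> = a" "eisenstein_E_7 2 \<tau> = - b" "eisenstein_E_7 4 \<tau> = c"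
    unfolding E by (simp_all only: sum_cube_roots_minus_one sum.cong[OF refl]) simp_all
  then show "eisenstein_E_7 1 \<tau> = 2 * lambert7_1 (nome \<tau>) + lambert7_2 (nome \<tau>) - lambert7_4 (nome \<tau>)"
    "eisenstein_E_7 2 \<tau> = lambert7_1 (nome \<tau>) - lambert7_2 (nome \<tau>) + 2 * lambert7_4 (nome \<tau>)"
    "eisenstein_E_7 4 \<tau> = - lambert7_1 (nome \<tau>) + 2 * lambert7_2 (nome \<tau>) + lambert7_4 (nome \<tau>)"
    by (simp_all add: a_def b_def c_def)
qed

theorem theorem5p1:
  fixes \<tau> :: complex
  assumes "Im \<tau> > 0"
  shows "eisenstein_E_7 2 \<tau> * eisenstein_E_7 4 \<tau>
       + eisenstein_E_7 2 \<tau> * eisenstein_E_7 1 \<tau>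
       + eisenstein_E_7 4 \<tau> * eisenstein_E_7 1 \<tau> = 0"
proof -
  let ?q = "nome \<tau>"
  have "?q \<noteq> 0" "norm ?q < 1" using assms by (simp_all add: nome_def)
  \<comment> \<open>With A, B, C for the three shifted series, the left-hand side expands to 5 (A B
    + B C + C A) - (A^2 + B^2 + C^2).\<close>
  from lambert7_quadratic_relation[OF this] show ?thesis
    unfolding eisenstein_E_7_eq[OF assms] by (simp add: algebra_simps power2_eq_square)
qed

end
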